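(* For all integers $t\ge 4$ and $n\ge 2t$, $ex_{\mathcal{P}}(n,M_t)=\min\{3n-6,\ 2n+3t-13\}$.
   Context: All graphs are finite, simple and undirected. $M_t$ denotes a matching with $t$ edges (i.e., $t$ pairwise disjoint edges). The planar Turán number $ex_{\mathcal{P}}(n,H)$ is the maximum number of edges in a planar graph on $n$ vertices that contains no subgraph isomorphic to $H$. *)

theory Defs
  imports "HOL-Analysis.Analysis"
begin

type_synonym 'a graph = "'a set \<times> 'a set set"

abbreviation verts :: "'a graph \<Rightarrow> 'a set" where
  "verts G \<equiv> fst G"

abbreviation edges :: "'a graph \<Rightarrow> 'a set set" where
  "edges G \<equiv> snd G"

definition simple_graph :: "'a graph \<Rightarrow> bool" where
  "simple_graph G \<longleftrightarrow> finite (verts G) \<and> (\<forall>e \<in> edges G. e \<subseteq> verts G \<and> card e = 2)"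

definition subgraph_of :: "'a graph \<Rightarrow> 'a graph \<Rightarrow> bool" where
  "subgraph_of H G \<longleftrightarrow> simple_graph H \<and> verts H \<subseteq> verts G \<and> edges H \<subseteq> edges G"

definition isomorphic :: "'a graph \<Rightarrow> 'b graph \<Rightarrow> bool" where
  "isomorphic G H \<longleftrightarrow>
     (\<exists>f. bij_betw f (verts G) (verts H) \<and> bij_betw (\<lambda>e. f ` e) (edges G) (edges H))"

definition contains_copy :: "'a graph \<Rightarrow> 'b graph \<Rightarrow> bool" where
  "contains_copy G H \<longleftrightarrow> (\<exists>G'. subgraph_of G' G \<and> isomorphic G' H)"

text \<open>The plane is \<^typ>\<open>complex\<close>, for which the library states the Jordan curve theorem.
  Vertices are drawn as distinct points and each edge as an arc joining its two ends; an arc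
  passes through no further vertex, and distinct arcs meet at most in common ends.\<close>

definition plane_drawing ::
    "'a graph \<Rightarrow> ('a \<Rightarrow> complex) \<Rightarrow> ('a set \<Rightarrow> real \<Rightarrow> complex) \<Rightarrow> bool" where
  "plane_drawing G p \<gamma> \<longleftrightarrow>
     inj_on p (verts G) \<and>
     (\<forall>e \<in> edges G. arc (\<gamma> e) \<and> {pathstart (\<gamma> e), pathfinish (\<gamma> e)} = p ` e \<and>
        path_image (\<gamma> e) \<inter> p ` verts G = p ` e) \<and>
     (\<forall>e \<in> edges G. \<forall>e' \<in> edges G. e \<noteq> e' \<longrightarrow>
        path_image (\<gamma> e) \<inter> path_image (\<gamma> e') \<subseteq> p ` (e \<inter> e'))"

definition planar :: "'a graph \<Rightarrow> bool" where
  "planar G \<longleftrightarrow> (\<exists>p \<gamma>. plane_drawing G p \<gamma>)"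

definition matching_graph :: "nat \<Rightarrow> nat graph" where
  "matching_graph t = ({..<2 * t}, (\<lambda>i. {2 * i, 2 * i + 1}) ` {..<t})"

text \<open>Every finite graph is isomorphic to one whose vertices are natural numbers, so it suffices
  to let the host graphs range over these. \<^const>\<open>Max\<close> is unspecified on infinite or empty sets;
  the lemmas below exclude both cases when \<open>H\<close> has an edge.\<close>

definition planar_turan_sizes :: "nat \<Rightarrow> 'b graph \<Rightarrow> nat set" where
  "planar_turan_sizes n H =
     {card (edges G) |G :: nat graph.
        simple_graph G \<and> card (verts G) = n \<and> planar G \<and> \<not> contains_copy G H}"

definition planar_turan_number :: "nat \<Rightarrow> 'b graph \<Rightarrow> nat" where
  "planar_turan_number n H = Max (planar_turan_sizes n H)"

lemma simple_graph_matching_graph: "simple_graph (matching_graph t)"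
  by (auto simp: simple_graph_def matching_graph_def)

lemma finite_planar_turan_sizes: "finite (planar_turan_sizes n H)"
proof (rule finite_subset)
  show "planar_turan_sizes n H \<subseteq> {..2 ^ n}"
  proof
    fix m assume "m \<in> planar_turan_sizes n H"
    then obtain G :: "nat graph"
      where G: "m = card (edges G)" "simple_graph G" "card (verts G) = n"
      unfolding planar_turan_sizes_def by blast
    have fin: "finite (verts G)" and sub: "edges G \<subseteq> Pow (verts G)"
      using G(2) by (auto simp: simple_graph_def)
    have "card (edges G) \<le> card (Pow (verts G))"
      using fin sub by (intro card_mono) auto
    then show "m \<in> {..2 ^ n}"
      using G fin by (simp add: card_Pow)
  qed
qed simp

lemma planar_turan_sizes_nonempty:
  assumes "edges H \<noteq> {}"
  shows "planar_turan_sizes n H \<noteq> {}"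
proof -
  let ?G = "({..<n}, {}) :: nat graph"
  have "planar ?G"
    unfolding planar_def plane_drawing_def
    by (rule exI[of _ "of_nat"]) (auto simp: inj_on_def)
  moreover have "\<not> contains_copy ?G H"
    using assms by (auto simp: contains_copy_def subgraph_of_def isomorphic_def bij_betw_def)
  ultimately have "card (edges ?G) \<in> planar_turan_sizes n H"
    unfolding planar_turan_sizes_def by (intro CollectI exI[of _ ?G]) (auto simp: simple_graph_def)
  then show ?thesis by blast
qed

end

theory Submission imports Defs begin

text \<open>Upper bound: a set \<open>S\<close> witnessing the Tutte-Berge formula splits the edges into those of a
  planar graph on \<open>A\<close> and a planar bipartite graph between \<open>S\<close> and the isolated vertices of \<open>G - S\<close>, so
  the bounds \<open>3 n - 6\<close> and \<open>2 n - 4\<close> add up to the claim. These two bounds hold for topological drawings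
  because every edge that closes a cycle splits a face (Jordan curve theorem), an edge on a cycle
  touches at most two faces, and the edges around a face separate the plane, hence are not too few
  (Janiszewski's theorem).

  Lower bound: a stacked triangulation on \<open>t - 1\<close> points with one further point put into each of its
  \<open>2 (t - 1) - 4\<close> faces, as long as there are points left, and the remaining points joined to two corners
  of a face. Every edge meets the \<open>t - 1\<close> points, which therefore bound every matching.\<close>

section \<open>Local separation by Jordan curves\<close>

text \<open>Write s, i and b for the sizes of \<open>S\<close>, of the union of the singleton parts
  and of the union of the larger parts. The two planar bounds give 3(s + b) - 6 + 2(s + i) - 4 = 2n
  + (3s + b) - 10. A matching number of at most t - 1, and odd larger parts having at least three
  vertices, give 3s + b <= 3t - 3; hence 13 = 10 + 3. The two terms of the minimum agree at n = 3t -
  7, which is the t - 1 cover points plus one point for each of the 2t - 6 faces: up to there a new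
  point gains three edges, afterwards two. Since drawings are arbitrary arcs, a face is handled
  through its closure instead of a boundary walk. Two estimates of the number of faces are played
  off against each other: a lower one by half of Euler's formula and an upper one by counting
  incidences of edges and faces. Girth becomes the topological condition that fewer than k edges do
  not separate the plane, with k = 3 in general and k = 4 without triangles.\<close>

lemma interior_path_image_arc:
  fixes g :: "real \<Rightarrow> complex"
  assumes "arc g"
  shows "interior (path_image g) = {}"
proof (rule ccontr)
  assume ne: "interior (path_image g) \<noteq> {}"
  obtain h where h: "homeomorphism {0..1} (path_image g) g h"
    using homeomorphism_arc[OF assms] by blast
  have "continuous_on (interior (path_image g)) h" "inj_on h (interior (path_image g))"
    using h interior_subset[of "path_image g"] unfolding homeomorphism_def
    by (blast intro: continuous_on_subset, metis inj_on_inverseI inj_on_subset)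
  \<comment> \<open>The inverse parametrisation would embed a nonempty open subset of the plane into
    the real line.\<close>
  from invariance_of_dimension[OF this(1) open_interior this(2) ne] show False by simp
qed

text \<open>Janiszewski's theorem is applied to the curve and to the union of a far subarc with a circle
  around \<open>x\<close>: these two sets meet exactly in that subarc.\<close>

lemma Jordan_curve_locally_two_sided:
  fixes c :: "real \<Rightarrow> complex"
  assumes c: "simple_path c" "pathfinish c = pathstart c"
    and x: "x \<in> path_image c" and \<epsilon>: "0 < \<epsilon>"
  obtains \<delta> where "0 < \<delta>"
    "\<And>a b. \<lbrakk>a \<in> ball x \<delta>; b \<in> ball x \<delta>; connected_component (- path_image c) a b\<rbrakk>
        \<Longrightarrow> connected_component (ball x \<epsilon> - path_image c) a b"
proof -
  obtain s where s: "s \<in> {0..1}" "x = c s" using x by (auto simp: path_image_def)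
  define d where "d = shiftpath s c"
  have d: "simple_path d" "path_image d = path_image c" "d 0 = x" "d 1 = x"
    using s c simple_path_shiftpath[OF c] path_image_shiftpath[of s c]
      pathstart_shiftpath[of s c] pathfinish_shiftpath[of s c]
    by (auto simp: d_def pathstart_def pathfinish_def)
  have cont: "continuous_on {0..1} d"
    using d(1) by (simp add: simple_path_imp_path flip: path_def)
  obtain r0 where r0: "r0 > 0" "\<And>y. y \<in> {0..1} \<Longrightarrow> dist y 0 < r0 \<Longrightarrow> dist (d y) x < \<epsilon>"
    using cont[unfolded continuous_on_iff, rule_format, of 0 \<epsilon>] \<epsilon> d by auto
  obtain r1 where r1: "r1 > 0" "\<And>y. y \<in> {0..1} \<Longrightarrow> dist y 1 < r1 \<Longrightarrow> dist (d y) x < \<epsilon>"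
    using cont[unfolded continuous_on_iff, rule_format, of 1 \<epsilon>] \<epsilon> d by auto
  define r where "r = Min {r0, r1, 1/2}"
  have r: "0 < r" "r \<le> r0" "r \<le> r1" "r \<le> 1/2" using r0 r1 by (auto simp: r_def)
  \<comment> \<open>Parameters within r of 0 or 1 are mapped into the ball of radius \<epsilon>, so
    \<beta> contains all of the curve on or outside the circle, yet not x.\<close>
  define \<beta> where "\<beta> = d ` {r..1 - r}"
  have sub: "{r..1-r} \<subseteq> {0..1}" using r by auto
  have \<beta>: "compact \<beta>" "connected \<beta>" "\<beta> \<subseteq> path_image c"
    unfolding \<beta>_def using sub cont d(2)
    by (auto simp: path_image_def intro!: compact_continuous_image connected_continuous_image
        intro: continuous_on_subset)
  have cover: "path_image c - ball x \<epsilon> \<subseteq> \<beta>"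
  proof
    fix y assume y: "y \<in> path_image c - ball x \<epsilon>"
    then have "y \<in> d ` {0..1}" using d(2) by (simp add: path_image_def)
    then obtain u where u: "u \<in> {0..1}" "y = d u" by blast
    have "dist (d u) x \<ge> \<epsilon>" using y u by (auto simp: dist_commute)
    then have "u \<ge> r0" "u \<le> 1 - r1" using r0(2)[of u] r1(2)[of u] u
      by (force simp: dist_real_def)+
    then show "y \<in> \<beta>" using r u by (auto simp: \<beta>_def)
  qed
  have "x \<notin> \<beta>"
  proof
    assume "x \<in> \<beta>"
    then obtain u where u: "r \<le> u" "u \<le> 1 - r" "d u = d 0" using d by (auto simp: \<beta>_def)
    moreover have "u \<in> {0..1}" using u r by auto
    ultimately have "u = 0 \<or> u = 1" using d(1) unfolding simple_path_def loop_free_def by force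
    then show False using u r by auto
  qed
  then have "open (- \<beta>)" "x \<in> - \<beta>" using compact_imp_closed[OF \<beta>(1)] by auto
  then obtain \<delta>0 where "\<delta>0 > 0" "ball x \<delta>0 \<subseteq> - \<beta>" by (rule openE)
  then have \<delta>0: "\<delta>0 > 0" "ball x \<delta>0 \<inter> \<beta> = {}" by auto
  define \<delta> where "\<delta> = min \<delta>0 \<epsilon>"
  have \<delta>: "\<delta> > 0" "\<delta> \<le> \<epsilon>" "ball x \<delta> \<inter> \<beta> = {}" using \<delta>0 \<epsilon> by (auto simp: \<delta>_def)
  show ?thesis
  proof (rule that[OF \<delta>(1)])
    fix a b assume a: "a \<in> ball x \<delta>" and b: "b \<in> ball x \<delta>"
      and ab: "connected_component (- path_image c) a b"
    have "(\<beta> \<union> sphere x \<epsilon>) \<inter> path_image c = \<beta>"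
      using \<beta> cover by (auto simp: dist_commute)
    moreover have "connected_component (- (\<beta> \<union> sphere x \<epsilon>)) a b"
      using a b \<delta> unfolding connected_component_def
      by (intro exI[of _ "ball x \<delta>"]) (auto simp: disjoint_iff)
    ultimately have "connected_component (- (\<beta> \<union> sphere x \<epsilon> \<union> path_image c)) a b"
      using \<beta> ab c closed_path_image[OF simple_path_imp_path]
      by (intro Janiszewski[of "\<beta> \<union> sphere x \<epsilon>" "path_image c"]) (simp_all add: compact_Un)
    then obtain Z where Z: "connected Z" "Z \<inter> (sphere x \<epsilon>) = {}" "Z \<inter> path_image c = {}" "a \<in> Z" "b \<in> Z"
      unfolding connected_component_def by blast
    \<comment> \<open>A connected set that starts inside the circle and avoids it cannot leave the
      ball.\<close>
    have "Z \<subseteq> ball x \<epsilon>"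
    proof (rule ccontr)
      assume "\<not> Z \<subseteq> ball x \<epsilon>"
      then have "Z \<inter> frontier (ball x \<epsilon>) \<noteq> {}"
        using a \<delta> Z by (intro connected_Int_frontier) (auto simp: disjoint_iff)
      then show False using Z \<epsilon> by auto
    qed
    then show "connected_component (ball x \<epsilon> - path_image c) a b"
      using Z unfolding connected_component_def by blast
  qed
qed

text \<open>Each component of the smaller set lies in one of the larger set, and \<open>meet\<close>
  makes the induced map onto. This map is not injective once a and b are separated in B but joined
  in A, whence the strict inequality.\<close>

lemma card_components_mono:
  assumes sub: "B \<subseteq> A" and meet: "\<And>D. D \<in> components A \<Longrightarrow> D \<inter> B \<noteq> {}"
    and fin: "finite (components B)"
  shows "finite (components A)" and "card (components A) \<le> card (components B)"
    and "\<lbrakk>a \<in> B; b \<in> B; connected_component A a b; \<not> connected_component B a b\<rbrakk>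
          \<Longrightarrow> card (components A) < card (components B)"
proof -
  define \<phi> where "\<phi> D = connected_component_set A (SOME x. x \<in> D)" for D
  have \<phi>: "\<phi> (connected_component_set B x) = connected_component_set A x" if "x \<in> B" for x
  proof -
    have "connected_component B x (SOME y. y \<in> connected_component_set B x)"
      using that by (metis (mono_tags) connected_component_refl mem_Collect_eq someI_ex)
    then have "connected_component A x (SOME y. y \<in> connected_component_set B x)"
      using sub by (meson connected_component_of_subset)
    then show ?thesis unfolding \<phi>_def by (metis connected_component_eq mem_Collect_eq)
  qed
  have im: "components A = \<phi> ` components B"
  proof (intro equalityI subsetI)
    fix D assume D: "D \<in> components A"
    then obtain x where x: "x \<in> D" "x \<in> B" using meet by blast
    then have "D = \<phi> (connected_component_set B x)"
      using D \<phi> by (metis components_iff connected_component_eq)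
    then show "D \<in> \<phi> ` components B" using x by (auto simp: components_def)
  next
    fix D assume "D \<in> \<phi> ` components B"
    then show "D \<in> components A" using \<phi> sub by (auto simp: components_def)
  qed
  show "finite (components A)" "card (components A) \<le> card (components B)"
    using im fin by (auto intro: card_image_le)
  assume ab: "a \<in> B" "b \<in> B" "connected_component A a b" "\<not> connected_component B a b"
  have "card (components A) \<noteq> card (components B)"
  proof
    assume "card (components A) = card (components B)"
    then have "inj_on \<phi> (components B)" using im fin by (simp add: eq_card_imp_inj_on)
    moreover have "\<phi> (connected_component_set B a) = \<phi> (connected_component_set B b)"
      using ab \<phi> by (metis connected_component_eq mem_Collect_eq)
    ultimately have "connected_component_set B a = connected_component_set B b"
      using ab by (auto simp: inj_on_def components_def)
    then show False using ab by (metis connected_component_refl mem_Collect_eq)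
  qed
  then show "card (components A) < card (components B)"
    using im fin card_image_le[of "components B" \<phi>] by simp
qed

section \<open>Faces of plane graphs and Euler's inequality\<close>

definition adj_rel :: "'a set set \<Rightarrow> ('a \<times> 'a) set" where
  "adj_rel X = {(u, v). {u, v} \<in> X}"

definition conn_class :: "'a set set \<Rightarrow> 'a \<Rightarrow> 'a set" where
  "conn_class X u = (adj_rel X)\<^sup>* `` {u}"

definition num_classes :: "'a set \<Rightarrow> 'a set set \<Rightarrow> nat" where
  "num_classes V X = card (conn_class X ` V)"

text \<open>The negation of being a bridge, phrased by walks: no cycle of the graph is ever
  constructed, because the simple closed curve is extracted topologically from the drawing.\<close>

definition on_cycle :: "'a set set \<Rightarrow> 'a set \<Rightarrow> bool" where
  "on_cycle X e \<longleftrightarrow> (\<exists>u v. e = {u, v} \<and> (u, v) \<in> (adj_rel (X - {e}))\<^sup>*)"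

lemma conn_class_mono: 
  assumes "X \<subseteq> Y"
  shows "conn_class Y u = (adj_rel Y)\<^sup>* `` conn_class X u"
proof -
  have "(adj_rel X)\<^sup>* \<subseteq> (adj_rel Y)\<^sup>*" using assms by (intro rtrancl_mono) (auto simp: adj_rel_def)
  then show ?thesis unfolding conn_class_def by (auto intro: rtrancl_trans)
qed

lemma num_classes_mono:
  assumes "finite V" "X \<subseteq> Y"
  shows "num_classes V Y \<le> num_classes V X"
proof -
  have "conn_class Y ` V = (\<lambda>A. (adj_rel Y)\<^sup>* `` A) ` conn_class X ` V"
    by (simp add: image_image conn_class_mono[OF assms(2)])
  then show ?thesis unfolding num_classes_def using assms(1) by (metis card_image_le finite_imageI)
qed

text \<open>Inserting e merges classes. If their number stayed the same, the merging map would be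
  injective and the ends of e would be joined already without e.\<close>

lemma num_classes_bridge:
  assumes "finite V" "e \<in> X" "e = {u, v}" "u \<in> V" "v \<in> V" "\<not> on_cycle X e"
  shows "num_classes V X < num_classes V (X - {e})"
proof -
  let ?Y = "X - {e}" and ?f = "\<lambda>A. (adj_rel X)\<^sup>* `` A"
  have eq: "conn_class X w = ?f (conn_class ?Y w)" for w by (rule conn_class_mono) auto
  have im: "conn_class X ` V = ?f ` conn_class ?Y ` V" by (simp add: image_image eq)
  have "(u, v) \<in> adj_rel X" "(v, u) \<in> adj_rel X"
    using assms by (auto simp: adj_rel_def insert_commute)
  then have uv: "conn_class X u = conn_class X v"
    unfolding conn_class_def by (auto intro: converse_rtrancl_into_rtrancl)
  have "num_classes V X \<noteq> num_classes V ?Y"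
  proof
    assume "num_classes V X = num_classes V ?Y"
    then have "inj_on ?f (conn_class ?Y ` V)"
      unfolding num_classes_def im using assms(1) by (simp add: eq_card_imp_inj_on)
    then have "conn_class ?Y u = conn_class ?Y v"
      using uv assms(4,5) unfolding eq by (auto dest: inj_onD)
    then have "(u, v) \<in> (adj_rel ?Y)\<^sup>*" by (auto simp: conn_class_def)
    then show False using assms by (auto simp: on_cycle_def)
  qed
  then show ?thesis using num_classes_mono[of V ?Y X] assms(1) by force
qed

lemma plane_drawingD:
  assumes "plane_drawing (V, E) p \<gamma>"
  shows "inj_on p V"
    and "\<And>e. e \<in> E \<Longrightarrow> arc (\<gamma> e)"
    and "\<And>e. e \<in> E \<Longrightarrow> {pathstart (\<gamma> e), pathfinish (\<gamma> e)} = p ` e"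
    and "\<And>e. e \<in> E \<Longrightarrow> path_image (\<gamma> e) \<inter> p ` V = p ` e"
    and "\<And>e e'. \<lbrakk>e \<in> E; e' \<in> E; e \<noteq> e'\<rbrakk> \<Longrightarrow> path_image (\<gamma> e) \<inter> path_image (\<gamma> e') \<subseteq> p ` (e \<inter> e')"
  using assms by (simp_all add: plane_drawing_def)

section \<open>Drawn edge sets and their faces\<close>

locale plane_graph =
  fixes V :: "'a set" and E :: "'a set set" and p :: "'a \<Rightarrow> complex"
    and \<gamma> :: "'a set \<Rightarrow> real \<Rightarrow> complex"
  assumes simple: "simple_graph (V, E)" and drawing: "plane_drawing (V, E) p \<gamma>"
begin

text \<open>All of V is included whatever X is, so that deleting an edge adds exactly its inner
  points to the complement.\<close>

definition point_set :: "'a set set \<Rightarrow> complex set" where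
  "point_set X = p ` V \<union> (\<Union>e\<in>X. path_image (\<gamma> e))"

definition open_edge :: "'a set \<Rightarrow> complex set" where
  "open_edge e = path_image (\<gamma> e) - p ` e"

abbreviation faces :: "'a set set \<Rightarrow> complex set set" where
  "faces X \<equiv> components (- point_set X)"

lemma finite_V: "finite V" and edge_subset: "e \<in> E \<Longrightarrow> e \<subseteq> V" and card_edge: "e \<in> E \<Longrightarrow> card e = 2"
  using simple by (auto simp: simple_graph_def)

lemma finite_E: "finite E"
  using finite_V edge_subset by (meson finite_Pow_iff finite_subset PowI subsetI)

lemmas inj_p = plane_drawingD(1)[OF drawing]
  and arc_edge = plane_drawingD(2)[OF drawing]
  and ends_edge = plane_drawingD(3)[OF drawing]
  and edge_Int_verts = plane_drawingD(4)[OF drawing]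
  and edge_Int_edge = plane_drawingD(5)[OF drawing]

lemma compact_point_set: "X \<subseteq> E \<Longrightarrow> compact (point_set X)"
  unfolding point_set_def using finite_V finite_E arc_edge
  by (intro compact_Un compact_UN finite_imp_compact finite_imageI compact_arc_image)
    (auto intro: finite_subset)

lemma open_complement: "X \<subseteq> E \<Longrightarrow> open (- point_set X)"
  using compact_point_set compact_imp_closed open_Compl by blast

lemma point_set_mono: "X \<subseteq> Y \<Longrightarrow> point_set X \<subseteq> point_set Y"
  by (auto simp: point_set_def)

lemma open_edge_disjoint:
  assumes "e \<in> E" "X \<subseteq> E"
  shows "open_edge e \<inter> point_set (X - {e}) = {}"
proof -
  have "z \<in> p ` e" if "z \<in> path_image (\<gamma> e)" "z \<in> path_image (\<gamma> e')" "e' \<in> X" "e' \<noteq> e" for z e'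
    using that edge_Int_edge[of e e'] assms by (auto simp: subset_iff)
  then show ?thesis
    using edge_Int_verts[OF assms(1)] by (auto simp: open_edge_def point_set_def)
qed

lemma open_edge_image: 
  assumes "e \<in> E" shows "open_edge e = \<gamma> e ` {0<..<1}"
proof -
  have "inj_on (\<gamma> e) {0..1}" using arc_edge[OF assms] by (simp add: arc_def)
  moreover have "p ` e = {\<gamma> e 0, \<gamma> e 1}" using ends_edge[OF assms] by (simp add: pathstart_def pathfinish_def)
  moreover have "{0..1::real} = {0<..<1} \<union> {0, 1}" by auto
  ultimately show ?thesis unfolding open_edge_def path_image_def
    by (auto simp: inj_on_def)
qed

lemma open_edge_nonempty: "e \<in> E \<Longrightarrow> open_edge e \<noteq> {}"
  by (simp add: open_edge_image)

lemma connected_open_edge: "e \<in> E \<Longrightarrow> connected (open_edge e)"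
  unfolding open_edge_image using arc_edge[of e]
  by (intro connected_continuous_image) (auto simp: arc_def path_def intro: continuous_on_subset)

lemma path_component_conn:
  assumes "X \<subseteq> E" "u \<in> V" "(u, v) \<in> (adj_rel X)\<^sup>*"
  shows "path_component (point_set X) (p u) (p v)"
  using assms(3)
proof induction
  case base
  then show ?case using assms by (simp add: path_component_refl point_set_def)
next
  case (step v w)
  then have e: "{v, w} \<in> X" by (simp add: adj_rel_def)
  then have "p v \<in> path_image (\<gamma> {v, w})" "p w \<in> path_image (\<gamma> {v, w})"
    using edge_Int_verts[of "{v, w}"] assms(1) by auto
  then have "path_component (path_image (\<gamma> {v, w})) (p v) (p w)"
    using e assms(1) arc_edge[of "{v,w}"] path_connected_path_image[OF arc_imp_path]
    unfolding path_connected_component by blast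
  then have "path_component (point_set X) (p v) (p w)"
    using e by (rule_tac path_component_of_subset[rotated]) (auto simp: point_set_def)
  with step.IH show ?case by (rule path_component_trans)
qed

text \<open>A walk avoiding e yields a path in the drawing of the other edges, and this path
  contains an arc between the ends of e. That arc closes up with e to a simple closed curve because
  the two meet only in these ends.\<close>

lemma on_cycle_Jordan:
  assumes X: "X \<subseteq> E" "e \<in> X" and cyc: "on_cycle X e"
  obtains c where "simple_path c" "pathfinish c = pathstart c"
    "path_image (\<gamma> e) \<subseteq> path_image c" "path_image c \<subseteq> point_set X"
proof -
  obtain u v where e: "e = {u, v}" and uv: "(u, v) \<in> (adj_rel (X - {e}))\<^sup>*"
    using cyc by (auto simp: on_cycle_def)
  have eE: "e \<in> E" using X by auto
  have uvV: "u \<in> V" "v \<in> V" "u \<noteq> v" using edge_subset[OF eE] card_edge[OF eE] e by auto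
  have ne: "p u \<noteq> p v" using inj_p uvV by (auto dest: inj_onD)
  have pc: "path_component (point_set (X - {e})) (p u) (p v)"
    using X uv uvV by (intro path_component_conn) auto
  obtain g where g: "arc g" "path_image g \<subseteq> point_set (X - {e})" "pathstart g = p u" "pathfinish g = p v"
  proof -
    obtain h where "path h" "path_image h \<subseteq> point_set (X - {e})" "pathstart h = p u" "pathfinish h = p v"
      using pc unfolding path_component_def by blast
    then show thesis using path_contains_arc[of h "p u" "p v"] ne that by (metis order_trans)
  qed
  have meet: "path_image (\<gamma> e) \<inter> path_image g \<subseteq> {p u, p v}"
    using open_edge_disjoint[OF eE X(1)] g(2) e by (auto simp: open_edge_def)
  have ends: "pathstart (\<gamma> e) = p v \<and> pathfinish (\<gamma> e) = p u \<or> pathstart (\<gamma> e) = p u \<and> pathfinish (\<gamma> e) = p v"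
    using ends_edge[OF eE] e by (auto simp: doubleton_eq_iff)
  obtain h where h: "arc h" "path_image h = path_image (\<gamma> e)" "pathstart h = p v" "pathfinish h = p u"
  proof (cases "pathstart (\<gamma> e) = p v")
    case True then show thesis using ends ne arc_edge[OF eE] that by metis
  next
    case False then show thesis using ends ne arc_edge[OF eE] that[of "reversepath (\<gamma> e)"]
      by (auto simp: arc_reversepath)
  qed
  have "simple_path (g +++ h)"
    using g h meet by (intro simple_path_join_loop) auto
  moreover have "path_image (g +++ h) = path_image g \<union> path_image (\<gamma> e)"
    using g h by (simp add: path_image_join)
  moreover have "path_image g \<subseteq> point_set X" "path_image (\<gamma> e) \<subseteq> point_set X"
    using g(2) point_set_mono[of "X - {e}" X] X by (auto simp: point_set_def)
  ultimately show thesis using that[of "g +++ h"] g h by auto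
qed

lemma edge_isolated:
  assumes "e \<in> E" "X \<subseteq> E" "x \<in> open_edge e"
  obtains \<epsilon> where "0 < \<epsilon>" "ball x \<epsilon> \<inter> point_set (X - {e}) = {}"
proof -
  have "X - {e} \<subseteq> E" using assms by auto
  from open_complement[OF this] show thesis
    using open_edge_disjoint[OF assms(1,2)] assms(3) that
    by (metis Compl_iff disjoint_iff open_contains_ball disjoint_eq_subset_Compl)
qed

text \<open>Near an inner point x of e the other edges are absent, so the drawing looks there like a
  Jordan curve through e, whose inside and outside give the two local sides. The last conclusion
  says that every face near x is one of the two and has the nearby part of e in its closure.\<close>

lemma edge_two_sided:
  assumes X: "X \<subseteq> E" "e \<in> X" and cyc: "on_cycle X e" and x: "x \<in> open_edge e"
  obtains \<delta> a b where "0 < \<delta>" "a \<in> ball x \<delta> - point_set X" "b \<in> ball x \<delta> - point_set X"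
    "\<not> connected_component (- point_set X) a b"
    "connected_component (- point_set (X - {e})) a b"
    "\<And>z y. \<lbrakk>z \<in> ball x \<delta> - point_set X; y \<in> open_edge e \<inter> ball x \<delta>\<rbrakk> \<Longrightarrow>
       (connected_component (- point_set X) z a \<or> connected_component (- point_set X) z b) \<and>
       y \<in> closure (connected_component_set (- point_set X) z)"
proof -
  have eE: "e \<in> E" using X by auto
  obtain c where c: "simple_path c" "pathfinish c = pathstart c"
    "path_image (\<gamma> e) \<subseteq> path_image c" "path_image c \<subseteq> point_set X"
    using on_cycle_Jordan[OF X cyc] .
  let ?C = "path_image c"
  have xC: "x \<in> ?C" using x c(3) by (auto simp: open_edge_def)
  obtain \<epsilon> where \<epsilon>: "0 < \<epsilon>" "ball x \<epsilon> \<inter> point_set (X - {e}) = {}"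
    using edge_isolated[OF eE X(1) x] .
  have ptX: "point_set X = point_set (X - {e}) \<union> path_image (\<gamma> e)"
    using X(2) by (auto simp: point_set_def)
  have ballX: "ball x \<epsilon> - ?C \<subseteq> - point_set X" using \<epsilon> c(3) ptX by auto
  obtain \<delta>0 where \<delta>0: "0 < \<delta>0"
    "\<And>a b. \<lbrakk>a \<in> ball x \<delta>0; b \<in> ball x \<delta>0; connected_component (- ?C) a b\<rbrakk>
        \<Longrightarrow> connected_component (ball x \<epsilon> - ?C) a b"
    using Jordan_curve_locally_two_sided[OF c(1,2) xC \<epsilon>(1)] by blast
  define \<delta> where "\<delta> = min \<delta>0 \<epsilon>"
  have \<delta>: "0 < \<delta>" "\<delta> \<le> \<delta>0" "\<delta> \<le> \<epsilon>" using \<delta>0 \<epsilon> by (auto simp: \<delta>_def)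
  \<comment> \<open>The points can be joined off the curve within the ball of radius \<epsilon>,
    where no other edge runs.\<close>
  have local: "connected_component (- point_set X) a b"
    if "a \<in> ball x \<delta>" "b \<in> ball x \<delta>" "connected_component (- ?C) a b" for a b
    using \<delta>0(2)[of a b] that \<delta> ballX connected_component_of_subset by (meson in_mono subset_ball)
  note J = Jordan_inside_outside[OF c(1,2)]
  have side: "connected_component (- ?C) a b"
    if "a \<in> inside ?C \<and> b \<in> inside ?C \<or> a \<in> outside ?C \<and> b \<in> outside ?C" for a b
  proof -
    have "inside ?C \<subseteq> - ?C" "outside ?C \<subseteq> - ?C"
      by (auto simp: inside_def outside_def)
    then show ?thesis using that J unfolding connected_component_def by blast
  qed
  have near: "(\<exists>z\<in>inside ?C. z \<in> U) \<and> (\<exists>z\<in>outside ?C. z \<in> U)" if "y \<in> ?C" "open U" "y \<in> U" for y U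
  proof -
    have "y \<in> closure (inside ?C)" "y \<in> closure (outside ?C)"
      using J that(1) by (metis Un_iff closure_Un_frontier)+
    then show ?thesis using that closure_iff_nhds_not_empty open_Int_closure_eq_empty
      by (metis disjoint_iff)
  qed
  obtain a b where ab: "a \<in> inside ?C" "a \<in> ball x \<delta>" "b \<in> outside ?C" "b \<in> ball x \<delta>"
    using near[OF xC open_ball, of x \<delta>] \<delta> by auto
  have notC: "a \<notin> ?C" "b \<notin> ?C" using ab by (auto simp: inside_def outside_def)
  have abX: "a \<in> ball x \<delta> - point_set X" "b \<in> ball x \<delta> - point_set X"
  proof -
    have "a \<in> ball x \<epsilon> - ?C" "b \<in> ball x \<epsilon> - ?C" using ab notC \<delta> by auto
    then show "a \<in> ball x \<delta> - point_set X" "b \<in> ball x \<delta> - point_set X"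
      using ab ballX by blast+
  qed
  have "\<not> connected_component (- ?C) a b"
    using ab(1,3) outside_same_component[of ?C b a] inside_Int_outside[of ?C]
    by (metis connected_component_sym disjoint_iff)
  then have sep: "\<not> connected_component (- point_set X) a b"
    using c(4) by (meson Compl_anti_mono connected_component_of_subset)
  have joined: "connected_component (- point_set (X - {e})) a b"
    unfolding connected_component_def using ab \<delta> \<epsilon>
    by (intro exI[of _ "ball x \<epsilon>"]) auto
  have both: "(connected_component (- point_set X) z a \<or> connected_component (- point_set X) z b) \<and>
       y \<in> closure (connected_component_set (- point_set X) z)"
    if z: "z \<in> ball x \<delta> - point_set X" and y: "y \<in> open_edge e \<inter> ball x \<delta>" for z y
  proof
    have zs: "z \<in> inside ?C \<or> z \<in> outside ?C"
      using z c(4) inside_Un_outside[of ?C] by blast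
    then show "connected_component (- point_set X) z a \<or> connected_component (- point_set X) z b"
      using local[of z a] local[of z b] side ab z by blast
    show "y \<in> closure (connected_component_set (- point_set X) z)"
      unfolding closure_iff_nhds_not_empty
    proof (intro allI impI)
      fix A U assume U: "U \<subseteq> A" "open U" "y \<in> U"
      have yC: "y \<in> ?C" using y c(3) by (auto simp: open_edge_def)
      have "open (U \<inter> ball x \<delta>)" "y \<in> U \<inter> ball x \<delta>" using U y by auto
      from near[OF yC this] obtain w where "w \<in> U \<inter> ball x \<delta>" "connected_component (- ?C) z w"
        using zs side by blast
      then have "connected_component (- point_set X) z w" using local z by auto
      then show "connected_component_set (- point_set X) z \<inter> A \<noteq> {}"
        using \<open>w \<in> U \<inter> ball x \<delta>\<close> U(1) by blast
    qed
  qed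
  show thesis using that[OF \<delta>(1) abX sep joined both] .
qed

text \<open>An arc has empty interior, so every face after the deletion of e contains points of a
  former face. If e lies on a cycle, the faces on its two sides become one.\<close>

lemma face_count_step:
  assumes X: "X \<subseteq> E" "e \<in> X" and fin: "finite (faces X)"
  shows "finite (faces (X - {e}))" "card (faces (X - {e})) \<le> card (faces X)"
    "on_cycle X e \<Longrightarrow> card (faces (X - {e})) < card (faces X)"
proof -
  have eE: "e \<in> E" using X by auto
  let ?A = "- point_set (X - {e})" and ?B = "- point_set X"
  have sub: "?B \<subseteq> ?A" using point_set_mono[of "X - {e}" X] by auto
  have ptX: "point_set X = point_set (X - {e}) \<union> path_image (\<gamma> e)"
    using X(2) by (auto simp: point_set_def)
  have meet: "D \<inter> ?B \<noteq> {}" if D: "D \<in> components ?A" for D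
  proof
    assume "D \<inter> ?B = {}"
    then have "D \<subseteq> path_image (\<gamma> e)" using ptX in_components_subset[OF D] by blast
    moreover have "open D" using open_components[OF open_complement D] X by auto
    ultimately have "D \<subseteq> interior (path_image (\<gamma> e))" by (rule interior_maximal)
    then show False using interior_path_image_arc[OF arc_edge[OF eE]] in_components_nonempty[OF D] by auto
  qed
  note mono = card_components_mono[OF sub meet fin]
  show "finite (faces (X - {e}))" "card (faces (X - {e})) \<le> card (faces X)" using mono by auto
  assume cyc: "on_cycle X e"
  obtain x where x: "x \<in> open_edge e" using open_edge_nonempty[OF eE] by auto
  show "card (faces (X - {e})) < card (faces X)"
    by (rule edge_two_sided[OF X cyc x]) (use mono(3) in blast)
qed

text \<open>Each inserted edge either splits a face or merges two classes. This half of Euler's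
  formula is the one that bounds the number of faces from below.\<close>

lemma Euler_inequality:
  assumes "X \<subseteq> E" "finite (faces X)"
  shows "card X + num_classes V X + 1 \<le> card (faces X) + card V"
proof -
  have "finite X" using assms(1) finite_E finite_subset by blast
  then show ?thesis using assms
  proof (induction X rule: finite_induct)
    case empty
    have "num_classes V {} \<le> card V" unfolding num_classes_def by (simp add: card_image_le finite_V)
    \<comment> \<open>The 1 on the left is paid for by the face that finitely many points
      leave.\<close>
    moreover have "- point_set {} \<noteq> {}"
      using finite_V ex_new_if_finite[of "p ` V"] infinite_UNIV_char_0[where ?'a = complex]
      by (auto simp: point_set_def)
    then have "card (faces {}) \<noteq> 0" using empty by (simp add: components_eq_empty)
    ultimately show ?case by simp
  next
    case (insert e X)
    have e: "e \<in> E" and [simp]: "insert e X - {e} = X" using insert by auto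
    obtain u v where uv: "e = {u, v}" "u \<in> V" "v \<in> V"
      using card_edge[OF e] edge_subset[OF e] by (auto simp: card_2_iff)
    note st = face_count_step[of "insert e X" e, simplified, OF _ insert.prems(2)]
    have IH: "card X + num_classes V X + 1 \<le> card (faces X) + card V"
      using insert.IH st insert.prems by auto
    show ?case
    proof (cases "on_cycle (insert e X) e")
      case True
      then show ?thesis using IH st(3) insert num_classes_mono[OF finite_V, of X "insert e X"] by force
    next
      case False
      then show ?thesis
        using IH st(2) insert num_classes_bridge[OF finite_V, of e "insert e X" u v] uv by force
    qed
  qed
qed

section \<open>Incidences between edges and faces\<close>

definition incident :: "'a set set \<Rightarrow> complex set \<Rightarrow> 'a set set" where
  "incident X F = {e \<in> X. closure F \<inter> open_edge e \<noteq> {}}"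

text \<open>The part of the open edge in the closure of F is relatively closed, and relatively open
  by the local description of the two sides; an open edge is connected.\<close>

lemma incident_closure:
  assumes X: "X \<subseteq> E" and cyc: "on_cycle X e" and F: "F \<in> faces X" and e: "e \<in> incident X F"
  shows "open_edge e \<subseteq> closure F"
proof -
  have eX: "e \<in> X" "e \<in> E" using e X by (auto simp: incident_def)
  have "openin (top_of_set (open_edge e)) (open_edge e \<inter> closure F)"
    unfolding openin_contains_ball
  proof (intro conjI ballI)
    fix x assume x: "x \<in> open_edge e \<inter> closure F"
    obtain \<delta> where \<delta>: "0 < \<delta>" and cl: "\<And>z y. \<lbrakk>z \<in> ball x \<delta> - point_set X; y \<in> open_edge e \<inter> ball x \<delta>\<rbrakk> \<Longrightarrow>
       y \<in> closure (connected_component_set (- point_set X) z)"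
      using edge_two_sided[OF X eX(1) cyc, of x] x by (metis IntD1)
    obtain z where z: "z \<in> F" "z \<in> ball x \<delta>"
      using x \<delta> open_Int_closure_eq_empty[of "ball x \<delta>" F] by (metis IntD2 IntI centre_in_ball disjoint_iff open_ball)
    have "F = connected_component_set (- point_set X) z"
      using F z(1) by (metis components_iff connected_component_eq)
    moreover have "z \<notin> point_set X" using z(1) in_components_subset[OF F] by blast
    ultimately show "\<exists>\<delta>>0. ball x \<delta> \<inter> open_edge e \<subseteq> open_edge e \<inter> closure F"
      using \<delta> cl z by blast
  qed auto
  moreover have "closedin (top_of_set (open_edge e)) (open_edge e \<inter> closure F)"
    by (auto simp: closedin_closed)
  ultimately have "open_edge e \<inter> closure F = {} \<or> open_edge e \<inter> closure F = open_edge e"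
    using connected_open_edge[OF eX(2)] unfolding connected_clopen by blast
  then show ?thesis using e by (auto simp: incident_def)
qed

text \<open>By \<open>incident_closure\<close> a single point of the edge decides which faces touch
  it, and near that point there are only two.\<close>

lemma card_incident_faces:
  assumes X: "X \<subseteq> E" and cyc: "on_cycle X e" and e: "e \<in> X"
  shows "finite {F \<in> faces X. e \<in> incident X F}" "card {F \<in> faces X. e \<in> incident X F} \<le> 2"
proof -
  obtain x where x: "x \<in> open_edge e" using open_edge_nonempty e X by blast
  obtain \<delta> a b where \<delta>: "0 < \<delta>" and sides:
      "\<And>z y. \<lbrakk>z \<in> ball x \<delta> - point_set X; y \<in> open_edge e \<inter> ball x \<delta>\<rbrakk> \<Longrightarrow>
       connected_component (- point_set X) z a \<or> connected_component (- point_set X) z b"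
    using edge_two_sided[OF X e cyc x] by (metis (no_types, lifting))
  have sub: "{F \<in> faces X. e \<in> incident X F} \<subseteq>
    {connected_component_set (- point_set X) a, connected_component_set (- point_set X) b}"
  proof
    fix F assume "F \<in> {F \<in> faces X. e \<in> incident X F}"
    then have F: "F \<in> faces X" "x \<in> closure F" using incident_closure[OF X cyc] x by auto
    obtain z where z: "z \<in> F" "z \<in> ball x \<delta>"
      using F(2) \<delta> open_Int_closure_eq_empty[of "ball x \<delta>" F] by (metis IntI centre_in_ball disjoint_iff open_ball)
    have "F = connected_component_set (- point_set X) z"
      using F(1) z(1) by (metis components_iff connected_component_eq)
    moreover have "z \<notin> point_set X" using z(1) in_components_subset[OF F(1)] by blast
    moreover have "x \<in> open_edge e \<inter> ball x \<delta>" using x \<delta> by auto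
    ultimately have "connected_component (- point_set X) z a \<or> connected_component (- point_set X) z b"
      using sides[of z x] z by blast
    then show "F \<in> {connected_component_set (- point_set X) a, connected_component_set (- point_set X) b}"
      using \<open>F = _\<close> by (metis connected_component_eq insertCI mem_Collect_eq)
  qed
  then show "finite {F \<in> faces X. e \<in> incident X F}" by (rule finite_subset) auto
  have "card {F \<in> faces X. e \<in> incident X F} \<le>
    card {connected_component_set (- point_set X) a, connected_component_set (- point_set X) b}"
    using sub by (intro card_mono) auto
  also have "\<dots> \<le> 2" by (simp add: card_insert_if)
  finally show "card {F \<in> faces X. e \<in> incident X F} \<le> 2" .
qed

text \<open>Otherwise the frontier of the face would lie in a set that does not separate the plane.\<close>

lemma face_degree:
  assumes X: "X \<subseteq> E" "X \<noteq> {}" and cyc: "\<And>e. e \<in> X \<Longrightarrow> on_cycle X e" and F: "F \<in> faces X"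
    and nonsep: "\<And>Y. \<lbrakk>Y \<subseteq> E; card Y < k\<rbrakk> \<Longrightarrow> connected (- point_set Y)"
  shows "k \<le> card (incident X F)"
proof (rule ccontr)
  assume "\<not> k \<le> card (incident X F)"
  let ?W = "point_set (incident X F)"
  have YX: "incident X F \<subseteq> X" by (auto simp: incident_def)
  have con: "connected (- ?W)" using nonsep \<open>\<not> k \<le> _\<close> YX X by auto
  have WX: "?W \<subseteq> point_set X" using point_set_mono[OF YX] .
  have opF: "open F" using open_components[OF open_complement[OF X(1)] F] .
  have FX: "F \<subseteq> - point_set X" using in_components_subset[OF F] .
  have fr: "closure F - F \<subseteq> ?W"
  proof
    fix z assume z: "z \<in> closure F - F"
    have "z \<in> point_set X"
    proof (rule ccontr)
      assume zX: "z \<notin> point_set X"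
      let ?D = "connected_component_set (- point_set X) z"
      have D: "?D \<in> faces X" using zX by (auto simp: components_def)
      have "open ?D" "z \<in> ?D" using open_components[OF open_complement[OF X(1)] D] zX by auto
      then have "F \<inter> ?D \<noteq> {}" using z open_Int_closure_eq_empty[of ?D F] by blast
      then have "F = ?D" using components_nonoverlap[OF F D] by auto
      then show False using z \<open>z \<in> ?D\<close> by auto
    qed
    then consider "z \<in> p ` V" | e where "e \<in> X" "z \<in> path_image (\<gamma> e)"
      by (auto simp: point_set_def)
    then show "z \<in> ?W"
    proof cases
      case (2 e)
      then show ?thesis
        using z X(1) edge_subset[of e] by (cases "z \<in> p ` e") (auto simp: point_set_def incident_def open_edge_def)
    qed (simp add: point_set_def)
  qed
  \<comment> \<open>F is relatively open and closed in the connected set - ?W, so it fills it. Then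
    the complement of the whole drawing is connected, whereas the two sides of an edge of X lie in
    different faces.\<close>
  have "F = - ?W \<inter> F" "F = - ?W \<inter> closure F"
    using FX WX fr closure_subset[of F] by blast+
  then have "openin (top_of_set (- ?W)) F" "closedin (top_of_set (- ?W)) F"
    using opF closed_closure unfolding openin_open closedin_closed by blast+
  then have "F = - ?W"
    using con in_components_nonempty[OF F] unfolding connected_clopen by blast
  then have eq: "- point_set X = - ?W" using FX WX by auto
  obtain e where e: "e \<in> X" using X by auto
  obtain x where x: "x \<in> open_edge e" using open_edge_nonempty e X by blast
  have "\<exists>a b. a \<in> - point_set X \<and> b \<in> - point_set X \<and> \<not> connected_component (- point_set X) a b"
    by (rule edge_two_sided[OF X(1) e cyc[OF e] x]) blast
  then show False using con unfolding eq connected_iff_connected_component by blast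
qed

text \<open>The hypothesis on small edge sets stands in for girth at least k. The first alternative
  covers forests, for which the second can fail, for instance when X is empty. Bridges are stripped
  off by induction; if edges remain, every face touches at least k of them, and the incidence count
  is combined with Euler's inequality.\<close>

lemma edge_bound_of_girth:
  assumes X: "X \<subseteq> E" and k: "2 \<le> k"
    and nonsep: "\<And>Y. \<lbrakk>Y \<subseteq> E; card Y < k\<rbrakk> \<Longrightarrow> connected (- point_set Y)"
  shows "card X + num_classes V X \<le> card V \<or>
    (k - 2) * card X + k * num_classes V X + k \<le> k * card V"
proof -
  have "finite X" using X finite_E finite_subset by blast
  then show ?thesis using X
  proof (induction X rule: finite_psubset_induct)
    case (psubset X)
    consider "X = {}" | e where "e \<in> X" "\<not> on_cycle X e" | "X \<noteq> {}" "\<And>e. e \<in> X \<Longrightarrow> on_cycle X e"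
      by blast
    then show ?case
    proof cases
      case 1
      then show ?thesis by (simp add: num_classes_def card_image_le finite_V)
    next
      case (2 e)
      have eE: "e \<in> E" using 2 psubset by auto
      obtain u v where uv: "e = {u, v}" "u \<in> V" "v \<in> V"
        using card_edge[OF eE] edge_subset[OF eE] by (auto simp: card_2_iff)
      have c: "num_classes V X + 1 \<le> num_classes V (X - {e})"
        using num_classes_bridge[OF finite_V 2(1) uv 2(2)] by simp
      have cX: "card X = card (X - {e}) + 1" using card.remove[OF psubset.hyps 2(1)] by simp
      have kc: "k * num_classes V X + k \<le> k * num_classes V (X - {e})"
        using mult_le_mono2[OF c, of k] by simp
      have "(k - 2) * card X \<le> (k - 2) * card (X - {e}) + k" unfolding cX by (simp add: distrib_left)
      have "X - {e} \<subset> X" "X - {e} \<subseteq> E" using 2 psubset.prems by auto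
      from psubset.IH[OF this] show ?thesis using c cX kc \<open>(k - 2) * card X \<le> _\<close> by linarith
    next
      case 3
      let ?I = "\<lambda>e. {F \<in> faces X. e \<in> incident X F}"
      have deg: "k \<le> card (incident X F)" if "F \<in> faces X" for F
        using face_degree[OF psubset.prems 3 that nonsep] .
      \<comment> \<open>Every face touches an edge and each edge touches at most two faces, which
        yields the finiteness that \<open>Euler_inequality\<close> presupposes.\<close>
      have "faces X \<subseteq> (\<Union>e\<in>X. ?I e)"
      proof
        fix F assume F: "F \<in> faces X"
        have "0 < card (incident X F)" using deg[OF F] k by linarith
        then have "incident X F \<noteq> {}" by (metis card.empty less_irrefl)
        then show "F \<in> (\<Union>e\<in>X. ?I e)" using F by (auto simp: incident_def)
      qed
      then have finF: "finite (faces X)"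
        using card_incident_faces(1)[OF psubset.prems 3(2)] psubset.hyps by (rule_tac finite_subset) auto
      have "k * card (faces X) \<le> (\<Sum>F\<in>faces X. card (incident X F))"
        using sum_bounded_below[of "faces X" k "\<lambda>F. card (incident X F)"] deg by (simp add: mult.commute)
      also have "\<dots> = (\<Sum>F\<in>faces X. \<Sum>e\<in>X. if e \<in> incident X F then 1 else 0)"
      proof (rule sum.cong[OF refl])
        fix F
        have "incident X F = {e \<in> X. e \<in> incident X F}" by (auto simp: incident_def)
        then show "card (incident X F) = (\<Sum>e\<in>X. if e \<in> incident X F then 1 else 0)"
          using psubset.hyps by (simp add: sum.If_cases Int_def)
      qed
      also have "\<dots> = (\<Sum>e\<in>X. \<Sum>F\<in>faces X. if e \<in> incident X F then 1 else 0)"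
        by (rule sum.swap)
      also have "\<dots> = (\<Sum>e\<in>X. card (?I e))"
        using finF by (simp add: sum.If_cases Int_def)
      also have "\<dots> \<le> 2 * card X"
        using sum_bounded_above[of X "\<lambda>e. card (?I e)" 2] card_incident_faces(2)[OF psubset.prems 3(2)]
        by (simp add: mult.commute)
      finally have le: "k * card (faces X) \<le> 2 * card X" .
      have "k * (card X + num_classes V X + 1) \<le> k * (card (faces X) + card V)"
        using Euler_inequality[OF psubset.prems finF] by (rule mult_le_mono2)
      then have "k * card X + k * num_classes V X + k \<le> 2 * card X + k * card V"
        using le by (simp add: algebra_simps)
      moreover have "k * card X = (k - 2) * card X + 2 * card X"
        using k le_add_diff_inverse2[of 2 k] by (metis add_mult_distrib)
      ultimately show ?thesis by simp
    qed
  qed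
qed

end

text \<open>A degenerate triple would put a singleton into X, so among two-element edges exactly the
  genuine triangles are excluded.\<close>

definition triangle_free :: "'a set set \<Rightarrow> bool" where
  "triangle_free X \<longleftrightarrow> \<not> (\<exists>u v w. {u, v} \<in> X \<and> {v, w} \<in> X \<and> {u, w} \<in> X)"

lemma card_2_Int_le_1:
  assumes "card e = 2" "card e' = 2" "e \<noteq> e'"
  shows "card (e \<inter> e') \<le> 1"
proof -
  have "finite e" "finite e'" using assms card.infinite by fastforce+
  moreover from this have "card (e \<inter> e') \<noteq> 2"
    using assms by (metis card_subset_eq inf_le1 inf_le2)
  moreover have "card (e \<inter> e') \<le> 2" using card_mono[of e "e \<inter> e'"] assms \<open>finite e\<close> by simp
  ultimately show ?thesis by linarith
qed

text \<open>Otherwise each of the three edges would lie in the union of the other two, and such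
  edges form a triangle. The edge found is the one to attach last when arcs are added one by
  one.\<close>

lemma triangle_free_edge_order:
  assumes "triangle_free {e1, e2, e3}" "card e1 = 2" "card e2 = 2" "card e3 = 2"
    "e1 \<noteq> e2" "e1 \<noteq> e3" "e2 \<noteq> e3"
    and "\<not> card (e1 \<inter> (e2 \<union> e3)) \<le> 1" "\<not> card (e2 \<inter> (e1 \<union> e3)) \<le> 1" 
  shows "card (e3 \<inter> (e1 \<union> e2)) \<le> 1"
proof (rule ccontr)
  assume 3: "\<not> card (e3 \<inter> (e1 \<union> e2)) \<le> 1"
  have sub: "e \<subseteq> S" if "card e = 2" "\<not> card (e \<inter> S) \<le> 1" for e S :: "'a set"
  proof -
    have "finite e" using that(1) card.infinite by fastforce
    moreover have "card (e \<inter> S) = card e" using that card_mono[of e "e \<inter> S"] \<open>finite e\<close> by auto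
    ultimately have "e \<inter> S = e" by (intro card_subset_eq) auto
    then show ?thesis by auto
  qed
  have s: "e1 \<subseteq> e2 \<union> e3" "e2 \<subseteq> e1 \<union> e3" "e3 \<subseteq> e1 \<union> e2"
    using sub assms 3 by blast+
  have eqI: "f = g" if "x \<in> f" "y \<in> f" "x \<noteq> y" "x \<in> g" "y \<in> g" "card f = 2" "card g = 2"
    for x y and f g :: "'a set"
    using that by (auto simp: card_2_iff)
  have tri: False if ab: "e1 = {a, b}" "a \<noteq> b" "a \<in> e2" for a b
  proof -
    have b: "b \<notin> e2" using eqI[of a e1 b e2] ab assms(2,3,5) by auto
    then have b3: "b \<in> e3" using s(1) ab by auto
    obtain w where w: "e2 = {a, w}" "a \<noteq> w"
      using assms(3) ab(3) by (metis card_2_iff insert_commute insertE singletonD)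
    have "w \<notin> e1" using eqI[of a e1 w e2] ab w assms(2,3,5) by auto
    then have "w \<in> e3" using s(2) w by auto
    then have "e3 = {b, w}" using eqI[of b e3 w "{b, w}"] b b3 w assms(4) by force
    then have "{b, a} \<in> {e1, e2, e3} \<and> {a, w} \<in> {e1, e2, e3} \<and> {b, w} \<in> {e1, e2, e3}"
      using ab(1) w(1) by (simp add: insert_commute)
    then show False using assms(1) unfolding triangle_free_def by blast
  qed
  obtain a b where ab: "e1 = {a, b}" "a \<noteq> b" using assms(2) by (meson card_2_iff)
  have "a \<in> e2 \<or> b \<in> e2"
  proof (rule ccontr)
    assume "\<not> (a \<in> e2 \<or> b \<in> e2)"
    then have "a \<in> e3" "b \<in> e3" using s(1) ab by auto
    then show False using eqI[of a e1 b e3] ab assms(2,4,6) by auto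
  qed
  then show False using tri[of a b] tri[of b a] ab by (auto simp: insert_commute)
qed

section \<open>Few edges do not separate the plane\<close>

context plane_graph begin

text \<open>The new arc meets the earlier ones in at most one point, hence in a connected set, and a
  single arc does not separate; so Janiszewski's theorem applies.\<close>

lemma connected_complement_insert:
  assumes Y: "Y \<subseteq> E" and e: "e \<in> E" "e \<notin> Y" "card (e \<inter> \<Union>Y) \<le> 1"
    and con: "connected (- (\<Union>e\<in>Y. path_image (\<gamma> e)))"
  shows "connected (- (\<Union>e\<in>insert e Y. path_image (\<gamma> e)))"
proof -
  let ?S = "\<Union>e\<in>Y. path_image (\<gamma> e)"
  have "finite Y" using Y finite_E finite_subset by blast
  then have cS: "compact ?S" using Y arc_edge
    by (intro compact_UN) (auto intro: compact_arc_image)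
  have fe: "finite e" using card_edge[OF e(1)] card.infinite by fastforce
  have "?S \<inter> path_image (\<gamma> e) \<subseteq> p ` (e \<inter> \<Union>Y)"
  proof
    fix z assume "z \<in> ?S \<inter> path_image (\<gamma> e)"
    then obtain e' where e': "e' \<in> Y" "z \<in> path_image (\<gamma> e') \<inter> path_image (\<gamma> e)" by auto
    then have "z \<in> p ` (e' \<inter> e)" using edge_Int_edge[of e' e] e Y by blast
    then show "z \<in> p ` (e \<inter> \<Union>Y)" using e' by auto
  qed
  moreover have "card (p ` (e \<inter> \<Union>Y)) \<le> 1" using card_image_le[of "e \<inter> \<Union>Y" p] fe e(3) by simp
  ultimately have "card (?S \<inter> path_image (\<gamma> e)) \<le> 1" "finite (?S \<inter> path_image (\<gamma> e))"
    using fe by (meson card_mono finite_Int finite_imageI finite_subset le_trans)+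
  then have "?S \<inter> path_image (\<gamma> e) = {} \<or> (\<exists>z. ?S \<inter> path_image (\<gamma> e) = {z})"
    by (metis One_nat_def card_0_eq card_1_singletonE le_SucE le_zero_eq)
  then have "connected (?S \<inter> path_image (\<gamma> e))" by auto
  then have "connected (- (?S \<union> path_image (\<gamma> e)))"
    using cS con closed_arc_image[OF arc_edge[OF e(1)]] connected_arc_complement[OF arc_edge[OF e(1)]]
    by (intro Janiszewski_connected) auto
  then show ?thesis by (simp add: Un_commute)
qed

lemma connected_complement_two:
  assumes "Y \<subseteq> E" "card Y \<le> 2"
  shows "connected (- (\<Union>e\<in>Y. path_image (\<gamma> e)))"
proof -
  have fin: "finite Y" using assms finite_E finite_subset by blast
  have one: "connected (- (\<Union>e\<in>{e}. path_image (\<gamma> e)))" if "e \<in> E" for e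
    using connected_arc_complement[OF arc_edge[OF that]] by simp
  consider "card Y = 0" | "card Y = 1" | "card Y = 2" using assms(2) by linarith
  then show ?thesis
  proof cases
    case 1 then show ?thesis using fin by (simp add: connected_UNIV)
  next
    case 2 then show ?thesis using one assms(1) by (auto simp: card_1_singleton_iff)
  next
    case 3
    then obtain e e' where Y: "Y = {e, e'}" "e \<noteq> e'" by (auto simp: card_2_iff)
    have "e \<in> E" "e' \<in> E" using Y assms(1) by auto
    moreover from this have "card (e \<inter> e') \<le> 1" using Y card_edge card_2_Int_le_1 by metis
    ultimately show ?thesis unfolding Y(1) using Y(2) one[of e']
      by (intro connected_complement_insert) auto
  qed
qed

lemma connected_complement_three:
  assumes "Y \<subseteq> E" "card Y \<le> 3" "triangle_free Y"
  shows "connected (- (\<Union>e\<in>Y. path_image (\<gamma> e)))"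
proof (cases "card Y \<le> 2")
  case True then show ?thesis using assms(1) by (intro connected_complement_two)
next
  case False
  then have "card Y = 3" using assms by simp
  then obtain e1 e2 e3 where Y: "Y = {e1, e2, e3}" "e1 \<noteq> e2" "e1 \<noteq> e3" "e2 \<noteq> e3"
    by (metis card_3_iff)
  have E: "e1 \<in> E" "e2 \<in> E" "e3 \<in> E" using Y assms(1) by auto
  have last: "connected (- (\<Union>e\<in>insert e {e', e''}. path_image (\<gamma> e)))"
    if "e \<in> E" "e' \<in> E" "e'' \<in> E" "e \<noteq> e'" "e \<noteq> e''" "card (e \<inter> (e' \<union> e'')) \<le> 1" for e e' e''
  proof -
    have "card {e', e''} \<le> 2" by (simp add: card_insert_if)
    then show ?thesis
      using that connected_complement_two[of "{e', e''}"] by (intro connected_complement_insert[of "{e', e''}" e]) simp_all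
  qed
  have "card (e1 \<inter> (e2 \<union> e3)) \<le> 1 \<or> card (e2 \<inter> (e1 \<union> e3)) \<le> 1 \<or> card (e3 \<inter> (e1 \<union> e2)) \<le> 1"
    using triangle_free_edge_order[of e1 e2 e3] Y assms(3) E card_edge by metis
  then have "connected (- (\<Union>e\<in>{e1, e2, e3}. path_image (\<gamma> e))) \<or>
      connected (- (\<Union>e\<in>{e2, e1, e3}. path_image (\<gamma> e))) \<or>
      connected (- (\<Union>e\<in>{e3, e1, e2}. path_image (\<gamma> e)))"
    using last[of e1 e2 e3] last[of e2 e1 e3] last[of e3 e1 e2] E Y(2-4) by presburger
  then show ?thesis unfolding Y(1) by (simp add: Int_ac)
qed

text \<open>What is still to be removed is a finite set of points, and a connected open set of the
  plane stays connected without it.\<close>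

lemma connected_complement_point_set:
  assumes "Y \<subseteq> E" "connected (- (\<Union>e\<in>Y. path_image (\<gamma> e)))"
  shows "connected (- point_set Y)"
proof -
  have "finite Y" using assms finite_E finite_subset by blast
  then have "closed (\<Union>e\<in>Y. path_image (\<gamma> e))"
    using assms arc_edge by (intro closed_UN) (auto intro: closed_arc_image)
  then have "connected (- (\<Union>e\<in>Y. path_image (\<gamma> e)) - p ` V)"
    using assms(2) finite_V by (intro connected_open_delete_finite) (simp_all only: open_Compl, auto)
  moreover have "- (\<Union>e\<in>Y. path_image (\<gamma> e)) - p ` V = - point_set Y"
    by (auto simp: point_set_def)
  ultimately show ?thesis by simp
qed

section \<open>Edge bounds for planar graphs\<close>

lemma num_classes_pos: "V \<noteq> {} \<Longrightarrow> 1 \<le> num_classes V X"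
  using finite_V by (simp add: num_classes_def Suc_le_eq card_gt_0_iff)

text \<open>There is at least one class, so k = 3 gives 3n - 6. The forest alternative, at most n -
  1 edges, is below that from three vertices on.\<close>

lemma card_edges_le:
  assumes "3 \<le> card V"
  shows "card E + 6 \<le> 3 * card V"
proof -
  have "V \<noteq> {}" using assms by auto
  moreover have "connected (- point_set Y)" if "Y \<subseteq> E" "card Y < 3" for Y
    using that by (intro connected_complement_point_set connected_complement_two) auto
  ultimately show ?thesis
    using edge_bound_of_girth[of E 3] num_classes_pos[of E] assms by auto
qed

lemma card_edges_triangle_free_le:
  assumes "3 \<le> card V" "triangle_free E"
  shows "card E + 4 \<le> 2 * card V"
proof -
  have "V \<noteq> {}" using assms by auto
  moreover have "connected (- point_set Y)" if "Y \<subseteq> E" "card Y < 4" for Y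
  proof -
    have "triangle_free Y" using assms(2) that(1) unfolding triangle_free_def by blast
    then show ?thesis
      using that by (intro connected_complement_point_set connected_complement_three) auto
  qed
  ultimately show ?thesis
    using edge_bound_of_girth[of E 4] num_classes_pos[of E] assms by auto
qed

end

lemma planar_subgraph:
  assumes "planar (V, E)" "V' \<subseteq> V" "E' \<subseteq> E" "\<And>e. e \<in> E' \<Longrightarrow> e \<subseteq> V'"
  shows "planar (V', E')"
proof -
  obtain p \<gamma> where d: "plane_drawing (V, E) p \<gamma>" using assms(1) unfolding planar_def by blast
  note D = plane_drawingD[OF d]
  have E: "e \<in> E" if "e \<in> E'" for e using that assms(3) by blast
  have meet: "path_image (\<gamma> e) \<inter> p ` V' = p ` e" if e: "e \<in> E'" for e
  proof -
    have sub: "p ` e \<subseteq> p ` V'" "p ` V' \<subseteq> p ` V"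
      using assms(2) assms(4)[OF e] by (simp_all add: image_mono)
    then have "path_image (\<gamma> e) \<inter> p ` V' = (path_image (\<gamma> e) \<inter> p ` V) \<inter> p ` V'" by blast
    also have "\<dots> = p ` e" unfolding D(4)[OF E[OF e]] using sub(1) by blast
    finally show ?thesis .
  qed
  have "plane_drawing (V', E') p \<gamma>"
    unfolding plane_drawing_def fst_conv snd_conv
    by (intro conjI ballI impI meet D(2,3,5) E inj_on_subset[OF D(1) assms(2)])
  then show ?thesis unfolding planar_def by blast
qed
lemma planar_card_edges_le:
  assumes "simple_graph (V, E)" "planar (V, E)" "3 \<le> card V"
  shows "card E + 6 \<le> 3 * card V"
proof -
  obtain p \<gamma> where "plane_drawing (V, E) p \<gamma>" using assms(2) by (auto simp: planar_def)
  then interpret plane_graph V E p \<gamma> using assms(1) by unfold_locales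
  show ?thesis using card_edges_le assms(3) .
qed

lemma planar_triangle_free_card_edges_le:
  assumes "simple_graph (V, E)" "planar (V, E)" "3 \<le> card V" "triangle_free E"
  shows "card E + 4 \<le> 2 * card V"
proof -
  obtain p \<gamma> where "plane_drawing (V, E) p \<gamma>" using assms(2) by (auto simp: planar_def)
  then interpret plane_graph V E p \<gamma> using assms(1) by unfold_locales
  show ?thesis using card_edges_triangle_free_le assms(3,4) .
qed

section \<open>The Tutte-Berge formula\<close>

definition is_matching :: "'a set set \<Rightarrow> 'a set set \<Rightarrow> bool" where
  "is_matching E M \<longleftrightarrow> M \<subseteq> E \<and> (\<forall>e\<in>M. \<forall>e'\<in>M. e \<noteq> e' \<longrightarrow> e \<inter> e' = {})"

definition max_matching :: "'a set set \<Rightarrow> 'a set set \<Rightarrow> bool" where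
  "max_matching E M \<longleftrightarrow> is_matching E M \<and> (\<forall>M'. is_matching E M' \<longrightarrow> card M' \<le> card M)"

lemma is_matching_subset: "\<lbrakk>is_matching E M; N \<subseteq> M\<rbrakk> \<Longrightarrow> is_matching E N"
  unfolding is_matching_def by (meson order_trans subsetD)

lemma is_matching_edge: "\<lbrakk>is_matching E M; e \<in> M\<rbrakk> \<Longrightarrow> e \<in> E"
  by (auto simp: is_matching_def)

lemma is_matching_unique: "\<lbrakk>is_matching E M; e \<in> M; f \<in> M; x \<in> e; x \<in> f\<rbrakk> \<Longrightarrow> e = f"
  unfolding is_matching_def by (metis disjoint_iff)

lemma is_matching_insert:
  assumes "is_matching E M" "e \<in> E" "e \<inter> \<Union>M = {}"
  shows "is_matching E (insert e M)"
proof -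
  have "e \<inter> f = {} \<and> f \<inter> e = {}" if "f \<in> M" for f using assms(3) that by blast
  then show ?thesis using assms(1,2) unfolding is_matching_def by simp
qed

lemma card_Union_matching:
  assumes "is_matching E M" "finite M" "\<And>e. e \<in> M \<Longrightarrow> card e = 2"
  shows "card (\<Union>M) = 2 * card M"
proof -
  have "card (\<Union>M) = sum card M"
    using assms card.infinite unfolding is_matching_def
    by (intro card_Union_disjoint) (fastforce simp: pairwise_def disjnt_def)+
  then show ?thesis using assms(3) by simp
qed

lemma max_matching_exists:
  assumes "finite E"
  obtains M where "max_matching E M"
proof -
  have "is_matching E {}" by (simp add: is_matching_def)
  moreover have "\<forall>M. is_matching E M \<longrightarrow> card M < Suc (card E)"
    using assms by (auto simp: is_matching_def less_Suc_eq_le card_mono)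
  ultimately have "\<exists>M. is_matching E M \<and> (\<forall>M'. is_matching E M' \<longrightarrow> card M' \<le> card M)"
    by (rule ex_has_greatest_nat)
  then show thesis using that unfolding max_matching_def by blast
qed

locale finite_graph =
  fixes V :: "'a set" and E :: "'a set set"
  assumes finite_V: "finite V" and edge: "e \<in> E \<Longrightarrow> e \<subseteq> V \<and> card e = 2"
begin

lemma finite_E: "finite E"
  using finite_V edge by (intro finite_subset[of E "Pow V"]) auto

lemma matchingD:
  assumes "is_matching E M"
  shows "finite M" "\<Union>M \<subseteq> V" "card (\<Union>M) = 2 * card M" "finite (\<Union>M)"
proof -
  show *: "finite M" "\<Union>M \<subseteq> V"
    using is_matching_edge[OF assms] edge finite_E by (auto intro: finite_subset)
  then show "card (\<Union>M) = 2 * card M"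
    using assms edge by (intro card_Union_matching[of E]) (auto simp: is_matching_def)
  show "finite (\<Union>M)" using * finite_V finite_subset by blast
qed

lemma max_matching_covers_edge:
  assumes "max_matching E M" "e \<in> E"
  shows "e \<inter> \<Union>M \<noteq> {}"
proof
  assume e: "e \<inter> \<Union>M = {}"
  have M: "is_matching E M" using assms by (simp add: max_matching_def)
  have "e \<noteq> {}" using edge[OF assms(2)] by auto
  then have "e \<notin> M" using e by blast
  then have "card (insert e M) = Suc (card M)" using matchingD[OF M] by simp
  moreover have "is_matching E (insert e M)" using is_matching_insert[OF M assms(2) e] .
  ultimately show False using assms(1) by (auto simp: max_matching_def)
qed

lemma matching_exchange:
  assumes N: "is_matching E N" and e: "e \<in> E" and f: "f \<in> N" "e \<inter> \<Union>N \<subseteq> f" "e \<notin> N"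
  shows "is_matching E (insert e (N - {f}))" "card (insert e (N - {f})) = card N"
proof -
  have "e \<inter> \<Union>(N - {f}) = {}"
  proof (rule ccontr)
    assume "e \<inter> \<Union>(N - {f}) \<noteq> {}"
    then obtain x g where x: "x \<in> e" "x \<in> g" "g \<in> N" "g \<noteq> f" by blast
    then have "x \<in> f" using f(2) by blast
    then show False using is_matching_unique[OF N f(1) x(3)] x by blast
  qed
  then show "is_matching E (insert e (N - {f}))"
    using N e is_matching_subset[OF N] by (intro is_matching_insert) auto
  have "finite N" using matchingD[OF N] by simp
  then show "card (insert e (N - {f})) = card N"
    using f card.remove[of N f] by simp
qed

text \<open>Among the maximum matchings that miss \<open>t\<close>, one with the largest intersection with \<open>M\<close> is
  exchanged along an edge of \<open>M\<close> and would meet \<open>M\<close> in one more edge.\<close>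

lemma jointly_covered_trans:
  assumes all: "\<And>v. v \<in> V \<Longrightarrow> \<exists>M. max_matching E M \<and> v \<notin> \<Union>M"
    and t: "t \<in> V" and uv: "u \<noteq> v"
    and ut: "\<And>M. max_matching E M \<Longrightarrow> u \<in> \<Union>M \<or> t \<in> \<Union>M"
    and tv: "\<And>M. max_matching E M \<Longrightarrow> t \<in> \<Union>M \<or> v \<in> \<Union>M"
    and M: "max_matching E M"
  shows "u \<in> \<Union>M \<or> v \<in> \<Union>M"
proof (rule ccontr)
  assume miss: "\<not> (u \<in> \<Union>M \<or> v \<in> \<Union>M)"
  have mM: "is_matching E M" using M by (simp add: max_matching_def)
  let ?P = "\<lambda>N. max_matching E N \<and> t \<notin> \<Union>N"
  obtain N0 where "?P N0" using all[OF t] by blast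
  moreover have "\<forall>N. ?P N \<longrightarrow> card (M \<inter> N) < Suc (card M)"
    using matchingD(1)[OF mM] by (simp add: less_Suc_eq_le card_mono)
  ultimately have "\<exists>N. ?P N \<and> (\<forall>N'. ?P N' \<longrightarrow> card (M \<inter> N') \<le> card (M \<inter> N))"
    by (rule ex_has_greatest_nat)
  then obtain N where NN: "?P N \<and> (\<forall>N'. ?P N' \<longrightarrow> card (M \<inter> N') \<le> card (M \<inter> N))" by (rule exE)
  then have N: "max_matching E N" "t \<notin> \<Union>N" by simp_all
  have best: "card (M \<inter> N') \<le> card (M \<inter> N)" if "max_matching E N'" "t \<notin> \<Union>N'" for N'
    using NN that by simp
  have mN: "is_matching E N" using N by (simp add: max_matching_def)
  note fM = matchingD[OF mM] and fN = matchingD[OF mN]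
  have "u \<in> \<Union>N" "v \<in> \<Union>N" using ut[OF N(1)] tv[OF N(1)] N(2) by blast+
  then have "{u, v} \<subseteq> \<Union>N - \<Union>M" using miss by blast
  then have "card {u, v} \<le> card (\<Union>N - \<Union>M)" by (intro card_mono finite_Diff fN(4))
  then have "2 \<le> card (\<Union>N - \<Union>M)" using uv by simp
  moreover have "card (\<Union>M) = card (\<Union>N)"
    using fM(3) fN(3) M N(1) unfolding max_matching_def by (metis le_antisym)
  then have "card (\<Union>M - \<Union>N) = card (\<Union>N - \<Union>M)"
    using fM(4) fN(4) by (simp add: card_Diff_subset_Int Int_commute)
  \<comment> \<open>N covers u and v, which M misses; as both matchings have the same size, M covers
    at least two vertices that N misses, one of them different from t.\<close>
  ultimately have "\<not> \<Union>M - \<Union>N \<subseteq> {t}" using card_mono[of "{t}" "\<Union>M - \<Union>N"] by auto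
  then obtain x e where x: "x \<in> e" "e \<in> M" "x \<notin> \<Union>N" "x \<noteq> t" by blast
  have eE: "e \<in> E" using is_matching_edge[OF mM x(2)] .
  obtain y where y: "e = {x, y}" "x \<noteq> y" using edge[OF eE] x(1) by (metis card_2_iff insert_commute insertE singletonD)
  have "y \<in> \<Union>N" using max_matching_covers_edge[OF N(1) eE] x(3) y(1) by blast
  then obtain f where f: "f \<in> N" "y \<in> f" by blast
  have "e \<notin> N" using x by blast
  have "e \<inter> \<Union>N \<subseteq> f" using y f x(3) by blast
  note ex = matching_exchange[OF mN eE f(1) this \<open>e \<notin> N\<close>]
  let ?N' = "insert e (N - {f})"
  have "max_matching E ?N'" using ex N(1) by (simp add: max_matching_def)
  moreover have "t \<notin> \<Union>?N'" using N(2) y x \<open>y \<in> \<Union>N\<close> by blast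
  ultimately have "card (M \<inter> ?N') \<le> card (M \<inter> N)" by (rule best)
  moreover have "f \<notin> M"
    using is_matching_unique[OF mM x(2), of f y] y f \<open>e \<notin> N\<close> by auto
  then have "M \<inter> ?N' = insert e (M \<inter> N)" using x(2) by blast
  moreover have "finite (M \<inter> N)" using fM(1) by blast
  ultimately show False using \<open>e \<notin> N\<close> by simp
qed

text \<open>Distinct vertices are related when no maximum matching misses both; transitivity is
  \<open>jointly_covered_trans\<close>, and the ends of an edge are related. A fixed maximum
  matching misses at most one vertex of each class and pairs up the rest of such a class within it,
  so the missed vertices lie in different odd classes.\<close>

lemma Gallai_partition:
  assumes all: "\<And>v. v \<in> V \<Longrightarrow> \<exists>M. max_matching E M \<and> v \<notin> \<Union>M"
  obtains P M where "partition_on V P" "\<And>e. e \<in> E \<Longrightarrow> \<exists>C\<in>P. e \<subseteq> C" "is_matching E M"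
    "card V \<le> 2 * card M + card {C \<in> P. odd (card C)}"
proof -
  define R where "R = {(u, v). u \<in> V \<and> v \<in> V \<and>
    (u = v \<or> (\<forall>M. max_matching E M \<longrightarrow> u \<in> \<Union>M \<or> v \<in> \<Union>M))}"
  have R_iff: "(u, v) \<in> R \<longleftrightarrow> u \<in> V \<and> v \<in> V \<and>
    (u = v \<or> (\<forall>M. max_matching E M \<longrightarrow> u \<in> \<Union>M \<or> v \<in> \<Union>M))" for u v
    by (simp add: R_def)
  have "trans R"
  proof (rule transI)
    fix u t v assume uv: "(u, t) \<in> R" "(t, v) \<in> R"
    show "(u, v) \<in> R"
    proof (cases "u = v \<or> u = t \<or> t = v")
      case True then show ?thesis using uv R_iff by metis
    next
      case False
      have "u \<in> \<Union>M \<or> v \<in> \<Union>M" if "max_matching E M" for M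
      proof (rule jointly_covered_trans[OF all])
        show "t \<in> V" "u \<noteq> v" using uv False R_iff by metis+
        show "u \<in> \<Union>M \<or> t \<in> \<Union>M" "t \<in> \<Union>M \<or> v \<in> \<Union>M" if "max_matching E M" for M
          using uv False that R_iff by metis+
      qed (use that in simp_all)
      then show ?thesis using uv R_iff by metis
    qed
  qed
  moreover have "refl_on V R" "sym R" "R \<subseteq> V \<times> V"
    unfolding refl_on_def sym_def by (auto simp: R_iff)
  ultimately have eq: "equiv V R" by (simp add: equiv_def)
  have part: "partition_on V (V // R)" using partition_on_quotient[OF eq] .
  have in_class: "\<exists>C\<in>V // R. e \<subseteq> C" if e: "e \<in> E" for e
  proof -
    obtain u v where uv: "e = {u, v}" "u \<in> V" "v \<in> V" using edge[OF e] by (auto simp: card_2_iff)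
    have "u \<in> \<Union>M \<or> v \<in> \<Union>M" if "max_matching E M" for M
      using max_matching_covers_edge[OF that e] uv(1) by blast
    then have "(u, v) \<in> R" using uv R_iff by metis
    moreover have "(u, u) \<in> R" using uv R_iff by metis
    ultimately have "e \<subseteq> R `` {u}" using uv(1) by blast
    then show ?thesis using uv by (auto intro: quotientI)
  qed
  obtain M where M: "max_matching E M" using max_matching_exists[OF finite_E] .
  have mM: "is_matching E M" using M by (simp add: max_matching_def)
  note fM = matchingD[OF mM]
  have odd_class: "odd (card (R `` {v}))" if v: "v \<in> V" "v \<notin> \<Union>M" for v
  proof -
    let ?C = "R `` {v}"
    let ?M = "{e \<in> M. e \<subseteq> ?C}"
    have C: "?C \<in> V // R" using v by (simp add: quotientI)
    have "v \<in> ?C" using eq v(1) by (rule equiv_class_self)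
    have "?C - {v} = \<Union>?M"
    proof
      show "\<Union>?M \<subseteq> ?C - {v}" using v by blast
      show "?C - {v} \<subseteq> \<Union>?M"
      proof
        fix w assume w: "w \<in> ?C - {v}"
        then have "(v, w) \<in> R" "v \<noteq> w" by blast+
        then have "w \<in> \<Union>M" using v(2) M R_iff by metis
        then obtain e where e: "e \<in> M" "w \<in> e" by blast
        then obtain D where D: "D \<in> V // R" "e \<subseteq> D" using in_class[OF is_matching_edge[OF mM e(1)]] by blast
        have "w \<in> D \<inter> ?C" using D(2) e(2) w by blast
        then have "D = ?C" using quotient_disj[OF eq D(1) C] by blast
        then show "w \<in> \<Union>?M" using D e by blast
      qed
    qed
    moreover have "is_matching E ?M" by (rule is_matching_subset[OF mM]) auto
    from matchingD(3)[OF this] have "even (card (\<Union>?M))" by simp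
    ultimately have "even (card (?C - {v}))" by simp
    moreover have "?C \<subseteq> V" using equiv_type[OF eq] by blast
    then have "finite ?C" using finite_V finite_subset by blast
    then have "card ?C = Suc (card (?C - {v}))" using \<open>v \<in> ?C\<close> by (rule card.remove)
    ultimately show ?thesis by simp
  qed
  have "inj_on (\<lambda>v. R `` {v}) (V - \<Union>M)"
  proof (rule inj_onI)
    fix u v assume uv: "u \<in> V - \<Union>M" "v \<in> V - \<Union>M" "R `` {u} = R `` {v}"
    have "v \<in> V" using uv(2) by blast
    have "(u, v) \<in> R" by (rule eq_equiv_class[OF uv(3) eq \<open>v \<in> V\<close>])
    then have "u = v \<or> u \<in> \<Union>M \<or> v \<in> \<Union>M" using M R_iff by metis
    then show "u = v" using uv(1,2) by simp
  qed
  moreover have "(\<lambda>v. R `` {v}) ` (V - \<Union>M) \<subseteq> {C \<in> V // R. odd (card C)}"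
    using odd_class by (auto intro: quotientI)
  moreover have "finite (V // R)" using finite_V eq by (simp add: finite_quotient equiv_type)
  ultimately have "card (V - \<Union>M) \<le> card {C \<in> V // R. odd (card C)}"
    by (intro card_inj_on_le) auto
  moreover have "card V = card (\<Union>M) + card (V - \<Union>M)"
    using fM card_mono[OF finite_V fM(2)] by (simp add: card_Diff_subset)
  ultimately have "card V \<le> 2 * card M + card {C \<in> V // R. odd (card C)}" using fM by simp
  then show thesis using that[OF part in_class mM] by simp
qed

end

text \<open>The hard direction of the Tutte-Berge formula, with the components of \<open>G - S\<close> replaced by
  parts of a partition that no edge of \<open>G - S\<close> crosses.\<close>

theorem Tutte_Berge:
  assumes "simple_graph (V, E)"
  obtains S P M where "S \<subseteq> V" "partition_on (V - S) P"
    "\<forall>e\<in>E. e \<inter> S = {} \<longrightarrow> (\<exists>C\<in>P. e \<subseteq> C)" "is_matching E M"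
    "card V + card S \<le> 2 * card M + card {C \<in> P. odd (card C)}"
proof -
  have "finite V" "\<And>e. e \<in> E \<Longrightarrow> e \<subseteq> V \<and> card e = 2"
    using assms by (auto simp: simple_graph_def)
  then have "\<exists>S P M. S \<subseteq> V \<and> partition_on (V - S) P \<and> (\<forall>e\<in>E. e \<inter> S = {} \<longrightarrow> (\<exists>C\<in>P. e \<subseteq> C)) \<and>
    is_matching E M \<and> card V + card S \<le> 2 * card M + card {C \<in> P. odd (card C)}"
  proof (induction V arbitrary: E rule: finite_psubset_induct)
    case (psubset V)
    interpret finite_graph V E using psubset by unfold_locales auto
    show ?case
    proof (cases "\<forall>v\<in>V. \<exists>M. max_matching E M \<and> v \<notin> \<Union>M")
      case True
      show ?thesis
      proof (rule Gallai_partition)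
        fix P M assume "partition_on V P" "\<And>e. e \<in> E \<Longrightarrow> \<exists>C\<in>P. e \<subseteq> C" "is_matching E M"
          "card V \<le> 2 * card M + card {C \<in> P. odd (card C)}"
        then show ?thesis by (intro exI[of _ "{}"] exI[of _ P] exI[of _ M]) simp
      qed (use True in simp)
    next
      case False
      then obtain v where v: "v \<in> V" "\<And>M. max_matching E M \<Longrightarrow> v \<in> \<Union>M" by blast
      define E' where "E' = {e \<in> E. v \<notin> e}"
      have less: "V - {v} \<subset> V" using v(1) by blast
      have edge': "e \<subseteq> V - {v} \<and> card e = 2" if "e \<in> E'" for e
        using that edge[of e] by (auto simp: E'_def)
      have "\<exists>S P M. S \<subseteq> V - {v} \<and> partition_on (V - {v} - S) P \<and>
        (\<forall>e\<in>E'. e \<inter> S = {} \<longrightarrow> (\<exists>C\<in>P. e \<subseteq> C)) \<and> is_matching E' M \<and>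
        card (V - {v}) + card S \<le> 2 * card M + card {C \<in> P. odd (card C)}"
        by (rule psubset.IH[OF less]) (rule edge')
      then obtain S P M where "S \<subseteq> V - {v} \<and> partition_on (V - {v} - S) P \<and>
        (\<forall>e\<in>E'. e \<inter> S = {} \<longrightarrow> (\<exists>C\<in>P. e \<subseteq> C)) \<and> is_matching E' M \<and>
        card (V - {v}) + card S \<le> 2 * card M + card {C \<in> P. odd (card C)}"
        by (elim exE)
      then have IH: "S \<subseteq> V - {v}" "partition_on (V - {v} - S) P"
        "\<forall>e\<in>E'. e \<inter> S = {} \<longrightarrow> (\<exists>C\<in>P. e \<subseteq> C)" "is_matching E' M"
        "card (V - {v}) + card S \<le> 2 * card M + card {C \<in> P. odd (card C)}"
        by simp_all
      have mM: "is_matching E M" using IH(4) by (auto simp: is_matching_def E'_def)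
      \<comment> \<open>Every maximum matching of the whole graph covers v, so M is not maximum
        there. The gain of at least 2 on the right pays for v being counted both in V and in the new
        S.\<close>
      have "v \<notin> \<Union>M" using is_matching_edge[OF IH(4)] by (auto simp: E'_def)
      then have "\<not> max_matching E M" using v(2) by blast
      then obtain M' where M': "is_matching E M'" "card M < card M'"
        using mM unfolding max_matching_def by (meson not_le)
      have finS: "finite S" "v \<notin> S" using IH(1) finite_V finite_subset by blast+
      have "card V = Suc (card (V - {v}))" using finite_V v(1) by (rule card.remove)
      then have "card V + card (insert v S) \<le> 2 * card M' + card {C \<in> P. odd (card C)}"
        using IH(5) M'(2) finS by simp
      moreover have "V - insert v S = V - {v} - S" by blast
      moreover have "\<forall>e\<in>E. e \<inter> insert v S = {} \<longrightarrow> (\<exists>C\<in>P. e \<subseteq> C)"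
        using IH(3) by (simp add: E'_def)
      moreover have "insert v S \<subseteq> V" using IH(1) v(1) by blast
      ultimately show ?thesis using IH(2) M'(1)
        by (intro exI[of _ "insert v S"] exI[of _ P] exI[of _ M']) simp
    qed
  qed
  then obtain S P M where "S \<subseteq> V \<and> partition_on (V - S) P \<and>
    (\<forall>e\<in>E. e \<inter> S = {} \<longrightarrow> (\<exists>C\<in>P. e \<subseteq> C)) \<and>
    is_matching E M \<and> card V + card S \<le> 2 * card M + card {C \<in> P. odd (card C)}"
    by (elim exE)
  then show thesis by (intro that[of S P M]) simp_all
qed

section \<open>Copies of the matching graph and matchings\<close>

lemma inj_matching_edges: "inj (\<lambda>i::nat. {2 * i, 2 * i + 1})"
proof (rule injI)
  fix i j :: nat assume "{2 * i, 2 * i + 1} = {2 * j, 2 * j + 1}"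
  then show "i = j" unfolding doubleton_eq_iff by presburger
qed

lemma contains_copy_imp_matching:
  assumes "contains_copy G (matching_graph t)"
  obtains M where "is_matching (edges G) M" "card M = t"
proof -
  obtain G' f where G': "subgraph_of G' G"
    and bE: "bij_betw (\<lambda>e. f ` e) (edges G') (edges (matching_graph t))"
    using assms unfolding contains_copy_def isomorphic_def by (elim exE conjE)
  let ?h = "\<lambda>i::nat. {2 * i, 2 * i + 1}"
  have ed: "edges (matching_graph t) = ?h ` {..<t}" by (simp add: matching_graph_def)
  have "card (edges G') = t"
    using bij_betw_same_card[OF bE] inj_on_subset[OF inj_matching_edges] unfolding ed by (simp add: card_image)
  moreover have "is_matching (edges G) (edges G')"
    unfolding is_matching_def
  proof (intro conjI ballI impI)
    show "edges G' \<subseteq> edges G" using G' by (simp add: subgraph_of_def)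
    fix e e' assume e: "e \<in> edges G'" "e' \<in> edges G'" "e \<noteq> e'"
    have ne: "f ` e \<noteq> f ` e'" using bij_betw_imp_inj_on[OF bE] e by (auto dest: inj_onD)
    have "f ` e \<in> ?h ` {..<t}" "f ` e' \<in> ?h ` {..<t}"
      using bij_betwE[OF bE] e unfolding ed by auto
    then obtain i j where ij: "f ` e = ?h i" "f ` e' = ?h j" by (elim imageE)
    then have "i \<noteq> j" using ne by auto
    then have "?h i \<inter> ?h j = {}" by (auto; presburger)
    then have "f ` e \<inter> f ` e' = {}" using ij by simp
    then show "e \<inter> e' = {}" by blast
  qed
  ultimately show thesis using that by simp
qed

text \<open>The edge numbered i is mapped onto {2i, 2i + 1}, a chosen end to the even number.
  Injectivity on vertices and on edges follows by counting, since the images have the right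
  sizes.\<close>

lemma matching_imp_contains_copy:
  assumes G: "simple_graph G" and M: "is_matching (edges G) M" "card M = t"
  shows "contains_copy G (matching_graph t)"
proof -
  interpret finite_graph "verts G" "edges G"
    using G by unfold_locales (auto simp: simple_graph_def)
  note fM = matchingD[OF M(1)]
  have card2: "card e = 2" if "e \<in> M" for e using edge[OF is_matching_edge[OF M(1) that]] by simp
  obtain h where h: "bij_betw h M {..<t}"
    using ex_bij_betw_finite_nat[OF fM(1)] M(2) by (auto simp: atLeast0LessThan)
  define a where "a e = (SOME x. x \<in> e)" for e :: "'a set"
  define ed where "ed x = (SOME e. e \<in> M \<and> x \<in> e)" for x
  define f where "f x = 2 * h (ed x) + (if x = a (ed x) then 0 else 1)" for x
  have ed: "ed x = e" if "e \<in> M" "x \<in> e" for x e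
  proof -
    have "\<exists>e. e \<in> M \<and> x \<in> e" using that by blast
    from someI_ex[OF this] have "ed x \<in> M \<and> x \<in> ed x" by (simp add: ed_def)
    then show ?thesis using is_matching_unique[OF M(1), of "ed x" e x] that by simp
  qed
  have img: "f ` e = {2 * h e, 2 * h e + 1}" if e: "e \<in> M" for e
  proof -
    obtain x y where xy: "e = {x, y}" "x \<noteq> y" using card2[OF e] unfolding card_2_iff by blast
    have "a e \<in> e" using xy(1) unfolding a_def some_in_eq by blast
    then have "a e = x \<or> a e = y" using xy by simp
    moreover have "f x = 2 * h e + (if x = a e then 0 else 1)" "f y = 2 * h e + (if y = a e then 0 else 1)"
      using ed[OF e] xy by (simp_all add: f_def)
    ultimately show ?thesis using xy by (auto simp: insert_commute)
  qed
  have im_e: "(\<lambda>e. f ` e) ` M = (\<lambda>i. {2 * i, 2 * i + 1}) ` {..<t}"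
  proof -
    have "(\<lambda>e. f ` e) ` M = (\<lambda>e. {2 * h e, 2 * h e + 1}) ` M" by (rule image_cong[OF refl img])
    also have "\<dots> = (\<lambda>i. {2 * i, 2 * i + 1}) ` (h ` M)" by (simp only: image_image)
    finally show ?thesis using bij_betw_imp_surj_on[OF h] by simp
  qed
  have "card ((\<lambda>e. f ` e) ` M) = card M"
    unfolding im_e using inj_on_subset[OF inj_matching_edges] M(2) by (simp add: card_image)
  then have inj_e: "inj_on (\<lambda>e. f ` e) M" using fM(1) by (simp add: eq_card_imp_inj_on)
  have im_v: "f ` (\<Union>M) = {..<2 * t}"
  proof -
    have "f ` (\<Union>M) = \<Union>((\<lambda>e. f ` e) ` M)" by blast
    also have "\<dots> = (\<Union>i<t. {2 * i, 2 * i + 1})" unfolding im_e ..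
    also have "\<dots> = {..<2 * t}"
    proof
      show "{..<2 * t} \<subseteq> (\<Union>i<t. {2 * i, 2 * i + 1})"
      proof
        fix k assume "k \<in> {..<2 * t}"
        then have "k div 2 < t" "k = 2 * (k div 2) \<or> k = 2 * (k div 2) + 1" by auto
        then show "k \<in> (\<Union>i<t. {2 * i, 2 * i + 1})" by blast
      qed
    qed auto
    finally show ?thesis .
  qed
  then have inj_v: "inj_on f (\<Union>M)" using fM(3,4) M(2) by (simp add: eq_card_imp_inj_on)
  have "subgraph_of (\<Union>M, M) G"
    unfolding subgraph_of_def simple_graph_def using fM card2 is_matching_edge[OF M(1)]
    by (simp add: subset_iff) blast
  moreover have "isomorphic (\<Union>M, M) (matching_graph t)"
    unfolding isomorphic_def matching_graph_def bij_betw_def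
    using inj_v im_v inj_e im_e by (intro exI[of _ f]) simp
  ultimately show ?thesis unfolding contains_copy_def by blast
qed

section \<open>The upper bound\<close>

text \<open>Let \<open>I\<close> be the union of the singleton parts in the Tutte-Berge partition of \<open>V - S\<close>. Edges meeting
  \<open>I\<close> form a bipartite graph between \<open>S\<close> and \<open>I\<close>, the others lie in \<open>A = V - I\<close>; adding the two planar
  bounds is enough since the remaining odd parts have at least three vertices. When \<open>S \<union> I\<close> is too
  small for the bipartite bound, the edges are instead split along one odd part.\<close>

lemma planar_no_matching_card_edges_le:
  assumes simple: "simple_graph (V, E)" and planar: "planar (V, E)"
    and nomatch: "\<And>M. is_matching E M \<Longrightarrow> card M < t"
    and t: "4 \<le> t" and n: "2 * t \<le> card V"
  shows "card E + 13 \<le> 2 * card V + 3 * t"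
proof -
  have finV: "finite V" and edge: "\<And>e. e \<in> E \<Longrightarrow> e \<subseteq> V \<and> card e = 2"
    using simple by (auto simp: simple_graph_def)
  have finE: "finite E" using edge finV by (intro finite_subset[of E "Pow V"]) auto
  obtain S P M where S: "S \<subseteq> V" and P: "partition_on (V - S) P"
    and inP': "\<forall>e\<in>E. e \<inter> S = {} \<longrightarrow> (\<exists>C\<in>P. e \<subseteq> C)" and M: "is_matching E M"
    and TB: "card V + card S \<le> 2 * card M + card {C \<in> P. odd (card C)}"
    by (rule Tutte_Berge[OF simple])
  have inP: "\<exists>C\<in>P. e \<subseteq> C" if "e \<in> E" "e \<inter> S = {}" for e
    using inP' that by simp
  have sub_bound: "card E' + 6 \<le> 3 * card V'"
    if "V' \<subseteq> V" "E' \<subseteq> E" "\<And>e. e \<in> E' \<Longrightarrow> e \<subseteq> V'" "3 \<le> card V'" for V' E'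
  proof (rule planar_card_edges_le)
    show "simple_graph (V', E')"
      using that edge finV finite_subset unfolding simple_graph_def by auto
    show "planar (V', E')" by (rule planar_subgraph[OF planar that(1-3)])
  qed (fact that)
  have finS: "finite S" using S finV finite_subset by blast
  have finVS: "finite (V - S)" using finV by simp
  have UP: "\<Union>P = V - S" using partition_onD1[OF P] by simp
  have finP: "finite P" using finite_elements[OF finVS P] .
  have disjP: "C = D" if "C \<in> P" "D \<in> P" "x \<in> C" "x \<in> D" for C D x
    using partition_onD2[OF P] that unfolding disjoint_def by blast
  have finC: "finite C" if "C \<in> P" for C using that UP finVS by (metis Union_upper finite_subset)
  have ne: "C \<noteq> {}" if "C \<in> P" for C using partition_onD3[OF P] that by blast

  define P1 where "P1 = {C \<in> P. card C = 1}"
  define P2 where "P2 = {C \<in> P. card C \<noteq> 1}"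
  define O2 where "O2 = {C \<in> P2. odd (card C)}"
  define I where "I = \<Union>P1"
  define B where "B = \<Union>P2"
  have PP: "P1 \<subseteq> P" "P2 \<subseteq> P" "O2 \<subseteq> P2" "P1 \<union> P2 = P"
    by (auto simp: P1_def P2_def O2_def)
  have fins: "finite P1" "finite P2" "finite O2" using PP finP finite_subset by blast+
  have card_Un: "card (\<Union>Q) = sum card Q" if "Q \<subseteq> P" for Q
    using that finC by (intro card_Union_disjoint pairwise_subset[OF partition_onD2[OF P]]) auto
  have cI: "card I = card P1" unfolding I_def card_Un[OF PP(1)] by (simp add: P1_def)
  have O3: "3 \<le> card C" if "C \<in> O2" for C
    using that by (auto simp: O2_def P2_def elim!: oddE)
  have "3 * card O2 \<le> sum card O2" using sum_bounded_below[of O2 3 card] O3 by (simp add: mult.commute)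
  also have "\<dots> \<le> sum card P2" using PP(3) fins by (intro sum_mono2) auto
  also have "\<dots> = card B" unfolding B_def card_Un[OF PP(2)] ..
  finally have cB: "3 * card O2 \<le> card B" .
  have "{C \<in> P. odd (card C)} = P1 \<union> O2" by (auto simp: P1_def P2_def O2_def)
  then have "card {C \<in> P. odd (card C)} \<le> card P1 + card O2" by (simp add: card_Un_le)
  \<comment> \<open>The 2 on the left arises because a matching has at most t - 1 edges.\<close>
  then have TB': "card V + card S + 2 \<le> 2 * t + card I + card O2" using TB nomatch[OF M] cI by linarith
  have IB: "I \<union> B = V - S" using PP(4) UP by (auto simp: I_def B_def)
  have IBd: "I \<inter> B = {}"
  proof (rule ccontr)
    assume "I \<inter> B \<noteq> {}"
    then obtain x C D where CD: "C \<in> P1" "D \<in> P2" "x \<in> C" "x \<in> D" by (auto simp: I_def B_def)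
    then have "C = D" using disjP[of C D x] PP by blast
    then show False using CD(1,2) by (simp add: P1_def P2_def)
  qed
  have finIB: "finite I" "finite B" using IB finVS by (metis finite_Un)+
  have V_eq: "V = S \<union> I \<union> B" "S \<inter> I = {}" "S \<inter> B = {}" using IB S by auto
  then have cV: "card V = card S + card I + card B"
    using IBd finS finIB by (simp add: card_Un_disjoint Int_Un_distrib2)

  define A where "A = S \<union> B"
  have cA: "card A = card S + card B" unfolding A_def using V_eq finS finIB by (simp add: card_Un_disjoint)
  define EA where "EA = {e \<in> E. e \<subseteq> A}"
  define EI where "EI = {e \<in> E. e \<inter> I \<noteq> {}}"
  have "E = EA \<union> EI" using edge V_eq by (force simp: EA_def EI_def A_def)
  then have cE: "card E \<le> card EA + card EI" by (metis card_Un_le)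
  \<comment> \<open>A vertex of I is alone in its part, so no edge at it can avoid S.\<close>
  have EI: "\<exists>x\<in>S. \<exists>y\<in>I. e = {x, y}" if e: "e \<in> EI" for e
  proof -
    have eE: "e \<in> E" using e by (simp add: EI_def)
    obtain y where y: "y \<in> e" "y \<in> I" using e by (auto simp: EI_def)
    obtain x where x: "e = {x, y}" "x \<noteq> y" using edge[OF eE] y(1) by (metis card_2_iff insert_commute insertE singletonD)
    have "x \<in> S"
    proof (rule ccontr)
      assume "x \<notin> S"
      then have "e \<inter> S = {}" using x y V_eq by auto
      then obtain C where C: "C \<in> P" "e \<subseteq> C" using inP[OF eE] by blast
      obtain D where D: "D \<in> P" "card D = 1" "y \<in> D" using y by (auto simp: I_def P1_def)
      have "C = D" using disjP[OF C(1) D(1), of y] C D y by blast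
      then have "card e \<le> 1" using card_mono[OF finC[OF D(1)], of e] C D by simp
      then show False using edge[OF eE] by simp
    qed
    then show ?thesis using x y by blast
  qed
  have EI_bound: "card EI + 4 \<le> 2 * (card S + card I)" if "3 \<le> card S + card I"
  proof -
    have sub: "S \<union> I \<subseteq> V" "EI \<subseteq> E" using V_eq by (auto simp: EI_def)
    have in_SI: "e \<subseteq> S \<union> I" if "e \<in> EI" for e using EI[OF that] by auto
    have side: "(u \<in> S) \<noteq> (v \<in> S)" if "{u, v} \<in> EI" for u v
      using EI[OF that] V_eq(2) by (auto simp: doubleton_eq_iff)
    have "triangle_free EI"
      unfolding triangle_free_def using side by metis
    moreover have "simple_graph (S \<union> I, EI)"
      using in_SI edge sub finS finIB unfolding simple_graph_def by auto
    moreover have "planar (S \<union> I, EI)" by (rule planar_subgraph[OF planar sub in_SI])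
    moreover have "card (S \<union> I) = card S + card I"
      using V_eq finS finIB by (simp add: card_Un_disjoint)
    ultimately show ?thesis using planar_triangle_free_card_edges_le[of "S \<union> I" EI] that by simp
  qed
  have EI_empty: "EI = {}" if "card S = 0" using EI that finS by auto
  have EA_bound: "card EA + 6 \<le> 3 * card A" if "3 \<le> card A"
    using that V_eq by (intro sub_bound) (auto simp: EA_def A_def)

  consider "card A \<le> 2" | "3 \<le> card A" "3 \<le> card S + card I" | "3 \<le> card A" "card S + card I \<le> 2"
    by linarith
  then show ?thesis
  proof cases
    \<comment> \<open>Here EA has at most one edge, so there are at most 2n - 3 edges, and t >= 4
      gives 2n - 3 <= 2n + 3t - 13.\<close>
    case 1
    have "EA \<subseteq> {A}"
    proof
      fix e assume e: "e \<in> EA"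
      then have "e \<subseteq> A" "card e = 2" using edge by (auto simp: EA_def)
      moreover have "finite A" using finS finIB by (simp add: A_def)
      ultimately have "e = A" using 1 card_seteq by metis
      then show "e \<in> {A}" by simp
    qed
    then have "card EA \<le> 1" using card_mono[of "{A}" EA] by simp
    moreover have "card EI + 4 \<le> 2 * (card S + card I)" using EI_bound 1 cA cV n t by linarith
    ultimately show ?thesis using cE t unfolding cV by simp
  next
    case 2
    \<comment> \<open>In sizes, \<open>TB'\<close> reads 2s + b + 2 <= 2t + |O2|; with 3|O2| <= b
      this becomes the present inequality.\<close>
    have "3 * card S + card B + 3 \<le> 3 * t" using TB' cB unfolding cV by simp
    then show ?thesis using EI_bound[OF 2(2)] EA_bound[OF 2(1)] cE unfolding cV cA by simp
  next
    case 3
    show ?thesis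
    proof (cases "\<exists>C\<in>O2. 3 \<le> card (V - C)")
      case True
      then obtain C where C: "C \<in> O2" "3 \<le> card (V - C)" by blast
      have CP: "C \<in> P" using C PP by blast
      have CV: "C \<subseteq> V - S" using CP UP by blast
      \<comment> \<open>Every edge lies in S \<union> C or misses C, since an edge avoiding S stays
        in one part. The two bounds add up to 3n + 3s - 12, which suffices by s + i <= 2 and 3s + b
        + 3 <= 3t.\<close>
      define E1 where "E1 = {e \<in> E. e \<subseteq> S \<union> C}"
      define E2 where "E2 = {e \<in> E. e \<subseteq> V - C}"
      have "E \<subseteq> E1 \<union> E2"
      proof
        fix e assume e: "e \<in> E"
        show "e \<in> E1 \<union> E2"
        proof (cases "e \<inter> S = {}")
          case True
          then obtain D where D: "D \<in> P" "e \<subseteq> D" using inP[OF e] by blast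
          show ?thesis
          proof (cases "D = C")
            case False
            then have "D \<inter> C = {}" using disjP[OF D(1) CP] by blast
            then show ?thesis using e D edge[OF e] by (auto simp: E2_def)
          qed (use e D in \<open>auto simp: E1_def\<close>)
        next
          case False
          then obtain x where x: "x \<in> e" "x \<in> S" by blast
          obtain y where y: "e = {x, y}" using edge[OF e] x(1) by (metis card_2_iff insert_commute insertE singletonD)
          show ?thesis using x y e edge[OF e] CV by (cases "y \<in> C") (auto simp: E1_def E2_def)
        qed
      qed
      then have "card E \<le> card (E1 \<union> E2)" using finE by (intro card_mono) (auto simp: E1_def E2_def)
      then have cE12: "card E \<le> card E1 + card E2" using card_Un_le le_trans by blast
      have cSC: "card (S \<union> C) = card S + card C"
        using CV finS finC[OF CP] by (intro card_Un_disjoint) auto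
      have cVC: "card (V - C) + card C = card V"
        using CV finV finC[OF CP] card_mono[of V C] by (simp add: card_Diff_subset subset_iff)
      have "card E1 + 6 \<le> 3 * (card S + card C)"
        unfolding cSC[symmetric] using O3[OF C(1)] CV S cSC
        by (intro sub_bound) (auto simp: E1_def)
      moreover have "card E2 + 6 \<le> 3 * card (V - C)"
        using C(2) by (intro sub_bound) (auto simp: E2_def)
      moreover have "3 * card S + card B + 3 \<le> 3 * t" using TB' cB unfolding cV by simp
      ultimately show ?thesis using cE12 cVC 3(2) unfolding cV by simp
    next
      case False
      have "card O2 \<le> 1"
      proof (rule ccontr)
        assume "\<not> card O2 \<le> 1"
        then obtain C D where CD: "C \<in> O2" "D \<in> O2" "C \<noteq> D"
          using fins by (metis card_le_Suc0_iff_eq One_nat_def)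
        have "C \<in> P" "D \<in> P" using CD PP by blast+
        then have "D \<subseteq> V - C" using disjP[of C D] CD(3) UP by blast
        then have "3 \<le> card (V - C)" using O3[OF CD(2)] finV card_mono[of "V - C" D] by simp
        then show False using False CD(1) by blast
      qed
      \<comment> \<open>With n >= 2t and |O2| <= 1, \<open>TB'\<close> gives s + 1 <= i, and s + i
        <= 2 leaves only s = 0.\<close>
      then have S0: "card S = 0" using TB' 3(2) n unfolding cV by simp
      have "card E + 6 \<le> 3 * card B" using EA_bound[OF 3(1)] cE cA EI_empty[OF S0] S0 by simp
      \<comment> \<open>Now i >= 1 and b <= 2t - 1, so for 3b - 6 <= 2n + 3t - 13 it suffices that 6
        <= 2i + t.\<close>
      then show ?thesis
        using TB' 3(2) n t \<open>card O2 \<le> 1\<close> S0 unfolding cV by simp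
    qed
  qed
qed

section \<open>Stacked straight-line drawings\<close>

text \<open>\<open>Im (cnj u * q)\<close> is the cross product of the plane vectors u and q. It is
  constant on parallels to the line xy and grows by D, twice the signed area of the triangle, from x
  to z; normalising it gives the coordinate.\<close>

lemma triangle_coordinate:
  fixes x y z :: complex
  assumes "\<not> collinear {x, y, z}"
  obtains l :: "complex \<Rightarrow> real" and k :: real
  where "linear l" "l x + k = 0" "l y + k = 0" "l z + k = 1"
proof -
  define u v where "u = y - x" and "v = z - x"
  define D where "D = Im (cnj u * v)"
  have "\<not> collinear {0, u, v}"
    using assms collinear_3[of y x z] by (simp add: u_def v_def insert_commute)
  then have nz: "u \<noteq> 0" "\<And>c. v \<noteq> c *\<^sub>R u"
    using collinear_lemma[of u v] by auto
  have "D \<noteq> 0"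
  proof
    assume "D = 0"
    define r N where "r = Re (cnj u * v)" and "N = (cmod u)\<^sup>2"
    have r: "cnj u * v = of_real r" using \<open>D = 0\<close> by (simp add: D_def r_def complex_eq_iff)
    have N: "cnj u * u = of_real N" "N \<noteq> 0" "cnj u \<noteq> 0"
      using nz(1) complex_norm_square[of u] by (simp_all add: N_def mult.commute)
    have "cnj u * ((r / N) *\<^sub>R u) = of_real (r / N) * (cnj u * u)"
      by (simp add: scaleR_conv_of_real)
    also have "\<dots> = cnj u * v" unfolding N(1) r using N(2) by simp
    finally have "v = (r / N) *\<^sub>R u" using N(3) mult_left_cancel by metis
    then show False using nz(2) by blast
  qed
  define g where "g q = Im (cnj u * q)" for q
  have "linear (\<lambda>q. g q / D)"
    unfolding g_def by (rule linearI) (simp_all add: algebra_simps add_divide_distrib diff_divide_distrib)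
  moreover have "g y = g x" by (simp add: g_def u_def algebra_simps)
  then have "g y / D + - (g x / D) = 0" by simp
  moreover have "g z - g x = D" by (simp add: g_def D_def v_def algebra_simps)
  then have "g z / D + - (g x / D) = 1" using \<open>D \<noteq> 0\<close> by (simp flip: diff_divide_distrib)
  ultimately show thesis by (intro that[of "\<lambda>q. g q / D" "- (g x / D)"]) simp_all
qed

text \<open>The functions \<open>b u\<close> are the barycentric coordinates of the triangle \<open>T\<close>, and \<open>w\<close> is its
  centroid; on the subtriangle opposite to \<open>u\<close> the coordinate \<open>b u\<close> is the smallest one.\<close>

lemma triangle_centroid:
  fixes T :: "complex set"
  assumes T: "card T = 3" "\<not> collinear T"
  obtains w and b :: "complex \<Rightarrow> complex \<Rightarrow> real" where
    "w \<in> interior (convex hull T)"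
    "\<And>u p v v'. \<lbrakk>u \<in> T; p \<in> convex hull {w, u}; v \<in> T - {u}; v' \<in> T - {u}\<rbrakk> \<Longrightarrow> b v p = b v' p"
    "\<And>u p v. \<lbrakk>u \<in> T; p \<in> convex hull {w, u}; v \<in> T - {u}\<rbrakk> \<Longrightarrow> b v p \<le> b u p"
    "\<And>u p v. \<lbrakk>u \<in> T; p \<in> convex hull {w, u}; v \<in> T - {u}; b v p = b u p\<rbrakk> \<Longrightarrow> p = w"
    "\<And>u. u \<in> T \<Longrightarrow> \<not> collinear (insert w (T - {u}))"
    "\<And>u p v. \<lbrakk>u \<in> T; p \<in> interior (convex hull insert w (T - {u})); v \<in> T - {u}\<rbrakk> \<Longrightarrow> b u p < b v p"
proof -
  have others: "\<exists>v v'. T = {u, v, v'} \<and> T - {u} = {v, v'} \<and> u \<noteq> v \<and> u \<noteq> v' \<and> v \<noteq> v'" if u: "u \<in> T" for u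
  proof -
    have "finite T" using T(1) card.infinite by fastforce
    then have "card (T - {u}) = 2" using T(1) u by (simp add: card_Diff_singleton)
    then obtain v v' where vv: "T - {u} = {v, v'}" "v \<noteq> v'" by (meson card_2_iff)
    then have "T = {u, v, v'}" "u \<noteq> v" "u \<noteq> v'" using u by blast+
    then show ?thesis using vv by blast
  qed
  define Q where "Q u f \<longleftrightarrow>
    (\<exists>l k. linear l \<and> f = (\<lambda>p. l p + k)) \<and> f u = 1 \<and> (\<forall>v\<in>T - {u}. f v = 0)"
    for u and f :: "complex \<Rightarrow> real"
  have "\<forall>u\<in>T. \<exists>f. Q u f"
  proof
    fix u assume u: "u \<in> T"
    obtain v v' where v: "T = {u, v, v'}" "T - {u} = {v, v'}" using others[OF u] by blast
    have nc: "\<not> collinear {v, v', u}" using T(2) v(1) by (simp add: insert_commute)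
    obtain l :: "complex \<Rightarrow> real" and k where lk: "linear l" "l v + k = 0" "l v' + k = 0" "l u + k = 1"
      using triangle_coordinate[OF nc] by blast
    have "Q u (\<lambda>p. l p + k)" unfolding Q_def v(2) using lk by auto
    then show "\<exists>f. Q u f" by - (rule exI)
  qed
  from bchoice[OF this] obtain b where b: "\<forall>u\<in>T. Q u (b u)" by (rule exE)
  have b1: "b u u = 1" if "u \<in> T" for u using b that by (simp add: Q_def)
  have b0: "b u v = 0" if "u \<in> T" "v \<in> T" "u \<noteq> v" for u v using b that by (simp add: Q_def)
  have comb: "b u (\<alpha> *\<^sub>R p + \<beta> *\<^sub>R q + \<delta> *\<^sub>R r) = \<alpha> * b u p + \<beta> * b u q + \<delta> * b u r"
    if "u \<in> T" "\<alpha> + \<beta> + \<delta> = 1" for u p q r \<alpha> \<beta> \<delta>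
  proof -
    have "\<exists>(l :: complex \<Rightarrow> real) k. linear l \<and> b u = (\<lambda>p. l p + k)"
      using b that(1) by (simp add: Q_def)
    then obtain l :: "complex \<Rightarrow> real" and k where l: "linear l" "b u = (\<lambda>p. l p + k)" by (elim exE conjE)
    have "k = \<alpha> * k + \<beta> * k + \<delta> * k" using that(2) by (simp flip: distrib_right)
    then show ?thesis using l by (simp add: linear_add linear_scale algebra_simps)
  qed
  define w where "w = (1/3) *\<^sub>R (\<Sum>T)"
  have w: "w = (1/3) *\<^sub>R u + (1/3) *\<^sub>R v + (1/3) *\<^sub>R v'"
    if "T = {u, v, v'}" "u \<noteq> v" "u \<noteq> v'" "v \<noteq> v'" for u v v'
    unfolding w_def that(1) using that(2-4) by (simp add: scaleR_add_right)
  have bw: "b u w = 1/3" if u: "u \<in> T" for u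
  proof -
    obtain v v' where v: "T = {u, v, v'}" "T - {u} = {v, v'}" "u \<noteq> v" "u \<noteq> v'" "v \<noteq> v'"
      using others[OF u] by blast
    have "v \<in> T" "v' \<in> T" using v(1) by blast+
    then show ?thesis unfolding w[OF v(1,3-5)] using b1[OF u] b0[OF u] v(3,4) by (subst comb[OF u]) simp_all
  qed
  have seg: "\<exists>t. 0 \<le> t \<and> p = (1 - t) *\<^sub>R w + t *\<^sub>R u \<and> b u p = (1 - t) / 3 + t \<and> (\<forall>v\<in>T - {u}. b v p = (1 - t) / 3)"
    if u: "u \<in> T" and p: "p \<in> convex hull {w, u}" for u p
  proof -
    obtain t where t: "0 \<le> t" "p = (1 - t) *\<^sub>R w + t *\<^sub>R u"
      using p unfolding segment_convex_hull[symmetric] in_segment by blast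
    have bp: "b v p = (1 - t) * b v w + t * b v u" if "v \<in> T" for v
      using comb[OF that, of "1 - t" t 0 w u 0] t(2) by simp
    have "b v p = (1 - t) / 3" if v: "v \<in> T - {u}" for v
    proof -
      have "b v u = 0" using b0[of v u] v u by simp
      then show ?thesis using bp[of v] bw[of v] v by simp
    qed
    moreover have "b u p = (1 - t) / 3 + t" using bp[OF u] bw[OF u] b1[OF u] by simp
    ultimately show ?thesis using t by blast
  qed
  have ncol: "\<not> collinear (insert w (T - {u}))" if u: "u \<in> T" for u
  proof -
    obtain v v' where v: "T - {u} = {v, v'}" "v \<noteq> v'" using others[OF u] by blast
    have vT: "v \<in> T" "v' \<in> T" "u \<noteq> v" "u \<noteq> v'" using v(1) u by blast+
    have bv: "b v v = 1" "b v v' = 0" "b v' v' = 1" "b v' v = 0" "b u v = 0" "b u v' = 0"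
      using b1 b0 v(2) vT u by simp_all
    have False if "collinear {v, w, v'}"
    proof -
      have "collinear {0, v - w, v' - w}" using that collinear_3[of v w v'] by simp
      then consider "v = w" | "v' = w" | c where "v' - w = c *\<^sub>R (v - w)"
        unfolding collinear_lemma by force
      then show False
      proof cases
        case 1 then show False using bw[OF vT(1)] bv by simp
      next
        case 2 then show False using bw[OF vT(2)] bv by simp
      next
        \<comment> \<open>The coordinate of u forces c = 1, and then the coordinate of v' would be 0
          at v' instead of 1.\<close>
        case 3
        then have v': "v' = c *\<^sub>R v + (1 - c) *\<^sub>R w + 0 *\<^sub>R w" by (simp add: algebra_simps)
        have "b q v' = c * b q v + (1 - c) * b q w" if "q \<in> T" for q
          by (subst v', subst comb[OF that]) simp_all
        from this[OF u] this[OF vT(2)] show False using bv bw[OF u] bw[OF vT(2)] by simp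
      qed
    qed
    then show ?thesis using v(1) by (metis insert_commute)
  qed
  have reg: "b u p < b v p"
    if u: "u \<in> T" and p: "p \<in> interior (convex hull insert w (T - {u}))" and v: "v \<in> T - {u}" for u p v
  proof -
    obtain v' where v': "T - {u} = {v, v'}" "v \<noteq> v'" using others[OF u] v by (metis insertE insert_commute singletonD)
    have vT: "v \<in> T" "v' \<in> T" using v'(1) by blast+
    have "\<not> collinear {w, v, v'}" using ncol[OF u] v' by simp
    then obtain \<alpha> \<beta> \<delta> where c: "0 < \<alpha>" "0 < \<beta>" "0 < \<delta>" "\<alpha> + \<beta> + \<delta> = 1"
      "p = \<alpha> *\<^sub>R w + \<beta> *\<^sub>R v + \<delta> *\<^sub>R v'"
      using p v'(1) interior_convex_hull_3_minimal[of w v v'] by auto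
    have "u \<noteq> v" "u \<noteq> v'" using v'(1) by blast+
    then have "b u v = 0" "b u v' = 0" "b v v = 1" "b v v' = 0" using b1 b0 vT u v'(2) by simp_all
    then have "b u p = \<alpha> / 3" "b v p = \<alpha> / 3 + \<beta>"
      unfolding c(5) comb[OF u c(4)] comb[OF vT(1) c(4)] using bw[OF u] bw[OF vT(1)] by simp_all
    then show ?thesis using c(2) by simp
  qed
  show thesis
  proof (rule that[of w b])
    obtain x where "x \<in> T" using T(1) by fastforce
    then obtain y z where xyz: "T = {x, y, z}" "x \<noteq> y" "x \<noteq> z" "y \<noteq> z" using others by blast
    have "w \<in> {v. \<exists>\<alpha> \<beta> \<delta>. 0 < \<alpha> \<and> 0 < \<beta> \<and> 0 < \<delta> \<and> \<alpha> + \<beta> + \<delta> = 1 \<and> \<alpha> *\<^sub>R x + \<beta> *\<^sub>R y + \<delta> *\<^sub>R z = v}"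
      using w[OF xyz] by (intro CollectI exI[of _ "1/3"]) simp
    then show "w \<in> interior (convex hull T)"
      using T(2) xyz(1) interior_convex_hull_3_minimal[of x y z] by simp
    fix u p v assume up: "u \<in> T" "p \<in> convex hull {w, u}" and v: "v \<in> T - {u}"
    obtain t where t: "0 \<le> t" "p = (1 - t) *\<^sub>R w + t *\<^sub>R u" "b u p = (1 - t) / 3 + t"
      "\<forall>v\<in>T - {u}. b v p = (1 - t) / 3"
      using seg[OF up] by (elim exE conjE)
    have bv: "b v p = (1 - t) / 3" using t(4) v by (rule bspec)
    show "b v p = b v' p" if "v' \<in> T - {u}" for v' using bv bspec[OF t(4) that] by simp
    show "b v p \<le> b u p" unfolding bv t(3) using t(1) by simp
    show "p = w" if "b v p = b u p"
    proof -
      have "t = 0" using that unfolding bv t(3) by simp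
      then show ?thesis using t(2) by simp
    qed
  qed (fact ncol reg)+
qed

text \<open>A straight-line drawing whose vertices are points of the plane, with a set \<open>\<Phi>\<close> of empty triangles.\<close>

definition triangulated :: "complex set \<Rightarrow> complex set set \<Rightarrow> complex set set \<Rightarrow> bool" where
  "triangulated V E \<Phi> \<longleftrightarrow> simple_graph (V, E) \<and>
     (\<forall>e\<in>E. convex hull e \<inter> V \<subseteq> e) \<and>
     (\<forall>e\<in>E. \<forall>e'\<in>E. e \<noteq> e' \<longrightarrow> convex hull e \<inter> convex hull e' \<subseteq> e \<inter> e') \<and>
     (\<forall>T\<in>\<Phi>. T \<subseteq> V \<and> card T = 3 \<and> \<not> collinear T \<and> interior (convex hull T) \<inter> V = {}) \<and>
     (\<forall>T\<in>\<Phi>. \<forall>e\<in>E. interior (convex hull T) \<inter> convex hull e = {}) \<and>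
     (\<forall>T\<in>\<Phi>. \<forall>T'\<in>\<Phi>. T \<noteq> T' \<longrightarrow> interior (convex hull T) \<inter> interior (convex hull T') = {})"

lemma triangulatedD:
  assumes "triangulated V E \<Phi>"
  shows "finite V" "\<And>e. e \<in> E \<Longrightarrow> e \<subseteq> V" "\<And>e. e \<in> E \<Longrightarrow> card e = 2"
    "\<And>e. e \<in> E \<Longrightarrow> convex hull e \<inter> V \<subseteq> e"
    "\<And>e e'. \<lbrakk>e \<in> E; e' \<in> E; e \<noteq> e'\<rbrakk> \<Longrightarrow> convex hull e \<inter> convex hull e' \<subseteq> e \<inter> e'"
    "\<And>T. T \<in> \<Phi> \<Longrightarrow> T \<subseteq> V" "\<And>T. T \<in> \<Phi> \<Longrightarrow> card T = 3" "\<And>T. T \<in> \<Phi> \<Longrightarrow> \<not> collinear T"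
    "\<And>T. T \<in> \<Phi> \<Longrightarrow> interior (convex hull T) \<inter> V = {}"
    "\<And>T e. \<lbrakk>T \<in> \<Phi>; e \<in> E\<rbrakk> \<Longrightarrow> interior (convex hull T) \<inter> convex hull e = {}"
    "\<And>T T'. \<lbrakk>T \<in> \<Phi>; T' \<in> \<Phi>; T \<noteq> T'\<rbrakk> \<Longrightarrow> interior (convex hull T) \<inter> interior (convex hull T') = {}"
  using assms by (simp_all add: triangulated_def simple_graph_def)

lemma triangulated_finite:
  assumes "triangulated V E \<Phi>"
  shows "finite E" "finite \<Phi>"
proof -
  note D = triangulatedD[OF assms]
  have "E \<subseteq> Pow V" "\<Phi> \<subseteq> Pow V" using D(2,6) by blast+
  then show "finite E" "finite \<Phi>" using D(1) by (simp_all add: finite_subset)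
qed

lemma segment_into_triangle:
  fixes T :: "complex set"
  assumes "w \<in> interior (convex hull T)" "u \<in> T"
  shows "convex hull {w, u} \<subseteq> insert u (interior (convex hull T))"
proof -
  have "u \<in> closure (convex hull T)" using assms(2) by (meson closure_subset hull_inc subsetD)
  then have "open_segment w u \<subseteq> interior (convex hull T)"
    by (rule in_interior_closure_convex_segment[OF convex_convex_hull assms(1)])
  moreover have "convex hull {w, u} = open_segment w u \<union> {w, u}"
    by (metis closed_segment_eq_open segment_convex_hull)
  ultimately show ?thesis using assms(1) by auto
qed

text \<open>The point w is fixed before the set N of corners to which it is joined. All three
  subtriangles are kept even where a spoke is missing, since only their emptiness is recorded. New
  pieces stay inside T up to corners, which keeps them apart from the old ones; among themselves
  they are told apart by barycentric coordinates.\<close>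

lemma triangulated_insert:
  assumes tri: "triangulated V E \<Phi>" and T: "T \<in> \<Phi>"
  obtains w where "w \<notin> V"
    "\<And>N. N \<subseteq> T \<Longrightarrow> triangulated (insert w V) (E \<union> (\<lambda>u. {w, u}) ` N)
        ((\<Phi> - {T}) \<union> (\<lambda>u. insert w (T - {u})) ` T)"
proof -
  note D = triangulatedD[OF tri]
  let ?int = "\<lambda>T. interior (convex hull T)"
  obtain w and b :: "complex \<Rightarrow> complex \<Rightarrow> real" where w: "w \<in> ?int T"
    and b_eq: "\<And>u p v v'. \<lbrakk>u \<in> T; p \<in> convex hull {w, u}; v \<in> T - {u}; v' \<in> T - {u}\<rbrakk> \<Longrightarrow> b v p = b v' p"
    and b_le: "\<And>u p v. \<lbrakk>u \<in> T; p \<in> convex hull {w, u}; v \<in> T - {u}\<rbrakk> \<Longrightarrow> b v p \<le> b u p"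
    and b_w: "\<And>u p v. \<lbrakk>u \<in> T; p \<in> convex hull {w, u}; v \<in> T - {u}; b v p = b u p\<rbrakk> \<Longrightarrow> p = w"
    and ncol: "\<And>u. u \<in> T \<Longrightarrow> \<not> collinear (insert w (T - {u}))"
    and b_less: "\<And>u p v. \<lbrakk>u \<in> T; p \<in> ?int (insert w (T - {u})); v \<in> T - {u}\<rbrakk> \<Longrightarrow> b u p < b v p"
    using triangle_centroid[OF D(7,8)[OF T]] by blast
  have finT: "finite T" using D(1) D(6)[OF T] finite_subset by blast
  have wV: "w \<notin> V" using w D(9)[OF T] by blast
  have TV: "u \<in> V" "u \<noteq> w" if "u \<in> T" for u using that D(6)[OF T] wV by blast+
  have third: "\<exists>r. r \<in> T \<and> r \<noteq> u \<and> r \<noteq> v" for u v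
  proof (rule ccontr)
    assume "\<not> ?thesis"
    then have "T \<subseteq> {u, v}" by blast
    then have "card T \<le> card {u, v}" by (intro card_mono) simp_all
    also have "\<dots> \<le> 2" by (simp add: card_insert_if)
    finally show False using D(7)[OF T] by simp
  qed
  have spoke: "convex hull {w, u} \<subseteq> insert u (?int T)" if "u \<in> T" for u
    by (rule segment_into_triangle[OF w that])
  have sub: "?int (insert w (T - {u})) \<subseteq> ?int T" for u
  proof (rule interior_mono, rule hull_minimal)
    have "w \<in> convex hull T" using w interior_subset by blast
    moreover have "T \<subseteq> convex hull T" by (rule hull_subset)
    ultimately show "insert w (T - {u}) \<subseteq> convex hull T" by blast
  qed (rule convex_convex_hull)
  \<comment> \<open>On the spoke to u the coordinates other than that of u agree. Comparing with the
    third corner r on both spokes makes all three equal, which leaves only w.\<close>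
  have spokes: "convex hull {w, u} \<inter> convex hull {w, v} \<subseteq> {w}" if uv: "u \<in> T" "v \<in> T" "u \<noteq> v" for u v
  proof
    fix p assume p: "p \<in> convex hull {w, u} \<inter> convex hull {w, v}"
    obtain r where r: "r \<in> T" "r \<noteq> u" "r \<noteq> v" using third[of u v] by blast
    have "b v p = b r p" using b_eq[OF uv(1), of p v r] p uv r by simp
    moreover have "b u p = b r p" using b_eq[OF uv(2), of p u r] p uv r by simp
    ultimately show "p \<in> {w}" using b_w[OF uv(1), of p v] p uv by simp
  qed
  \<comment> \<open>The coordinate of u is strictly the smallest on this subtriangle, but on the
    spoke to v it is the largest (if u = v) or ties with that of the third corner.\<close>
  have sub_spoke: "?int (insert w (T - {u})) \<inter> convex hull {w, v} = {}" if uv: "u \<in> T" "v \<in> T" for u v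
  proof (rule ccontr)
    assume "\<not> ?thesis"
    then obtain p where p: "p \<in> ?int (insert w (T - {u}))" "p \<in> convex hull {w, v}" by blast
    obtain r where r: "r \<in> T" "r \<noteq> u" "r \<noteq> v" using third[of u v] by blast
    have less: "b u p < b r p" using b_less[OF uv(1) p(1)] r by simp
    show False
    proof (cases "u = v")
      case True then show False using b_le[OF uv(2) p(2), of r] r less by simp
    next
      case False then show False using b_eq[OF uv(2) p(2), of u r] r uv less by simp
    qed
  qed
  have subs: "?int (insert w (T - {u})) \<inter> ?int (insert w (T - {v})) = {}"
    if uv: "u \<in> T" "v \<in> T" "u \<noteq> v" for u v
  proof (rule ccontr)
    assume "\<not> ?thesis"
    then obtain p where "p \<in> ?int (insert w (T - {u}))" "p \<in> ?int (insert w (T - {v}))" by blast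
    then show False using b_less[OF uv(1), of p v] b_less[OF uv(2), of p u] uv by force
  qed
  have "triangulated (insert w V) (E \<union> (\<lambda>u. {w, u}) ` N)
        ((\<Phi> - {T}) \<union> (\<lambda>u. insert w (T - {u})) ` T)" (is "triangulated ?V ?E ?\<Phi>") if N: "N \<subseteq> T" for N
  proof -
    have NT: "u \<in> T" if "u \<in> N" for u using N that by blast
    have old_w: "w \<notin> convex hull e" if "e \<in> E" for e using D(10)[OF T that] w by blast
    have old_spoke: "convex hull e \<inter> convex hull {w, u} \<subseteq> e \<inter> {w, u}" if e: "e \<in> E" and u: "u \<in> T" for e u
    proof
      fix p assume p: "p \<in> convex hull e \<inter> convex hull {w, u}"
      then have "p = u" using spoke[OF u] D(10)[OF T e] by blast
      then show "p \<in> e \<inter> {w, u}" using D(4)[OF e] p TV(1)[OF u] by blast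
    qed
    have E_cases: "P e" if "e \<in> ?E" "e \<in> E \<Longrightarrow> P e" "\<And>u. \<lbrakk>u \<in> T; u \<in> N\<rbrakk> \<Longrightarrow> P {w, u}" for e P
      using that NT by blast
    have \<Phi>_cases: "P X" if "X \<in> ?\<Phi>" "\<lbrakk>X \<in> \<Phi>; X \<noteq> T\<rbrakk> \<Longrightarrow> P X" "\<And>u. u \<in> T \<Longrightarrow> P (insert w (T - {u}))" for X P
      using that by blast
    have 1: "simple_graph (?V, ?E)"
      unfolding simple_graph_def fst_conv snd_conv
    proof (intro conjI ballI)
      show "finite ?V" using D(1) by simp
      fix e assume e: "e \<in> ?E"
      show "e \<subseteq> ?V" by (rule E_cases[OF e]) (use D(2) TV(1) in auto)
      show "card e = 2"
      proof (rule E_cases[OF e])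
        fix u assume "u \<in> T"
        from TV(2)[OF this] have "w \<noteq> u" by simp
        then show "card {w, u} = 2" by simp
      qed (rule D(3))
    qed
    have 2: "convex hull e \<inter> ?V \<subseteq> e" if e: "e \<in> ?E" for e
    proof (rule E_cases[OF e])
      assume "e \<in> E" then show "convex hull e \<inter> ?V \<subseteq> e" using D(4)[of e] old_w[of e] by blast
    next
      fix u assume u: "u \<in> T"
      show "convex hull {w, u} \<inter> ?V \<subseteq> {w, u}" using spoke[OF u] D(9)[OF T] by blast
    qed
    have 3: "convex hull e \<inter> convex hull e' \<subseteq> e \<inter> e'" if e: "e \<in> ?E" "e' \<in> ?E" "e \<noteq> e'" for e e'
    proof -
      consider "e \<in> E" "e' \<in> E" | u where "e \<in> E" "u \<in> T" "e' = {w, u}"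
        | u where "e' \<in> E" "u \<in> T" "e = {w, u}" | u v where "u \<in> T" "v \<in> T" "e = {w, u}" "e' = {w, v}"
        using e(1,2) NT by blast
      then show ?thesis
      proof cases
        case 1 then show ?thesis using D(5) e(3) by simp
      next
        case 2 then show ?thesis using old_spoke by simp
      next
        case 3 then show ?thesis using old_spoke[of e' u] by blast
      next
        case 4 then show ?thesis using spokes[of u v] e(3) by blast
      qed
    qed
    have 4: "X \<subseteq> ?V \<and> card X = 3 \<and> \<not> collinear X \<and> ?int X \<inter> ?V = {}" if X: "X \<in> ?\<Phi>" for X
    proof (rule \<Phi>_cases[OF X])
      assume XX: "X \<in> \<Phi>" "X \<noteq> T"
      then have "w \<notin> ?int X" using D(11)[OF XX(1) T XX(2)] w by blast
      then show "X \<subseteq> ?V \<and> card X = 3 \<and> \<not> collinear X \<and> ?int X \<inter> ?V = {}"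
        using D(6-9)[OF XX(1)] by blast
    next
      fix u assume u: "u \<in> T"
      have "card (T - {u}) = 2" using D(7)[OF T] u finT by simp
      then have "card (insert w (T - {u})) = 3" using TV(2) finT by (subst card_insert_disjoint) auto
      moreover have "w \<notin> ?int (insert w (T - {u}))"
        using sub_spoke[OF u u] hull_inc[of w "{w, u}" convex] by blast
      then have "?int (insert w (T - {u})) \<inter> ?V = {}" using sub[of u] D(9)[OF T] by blast
      moreover have "insert w (T - {u}) \<subseteq> ?V" using TV(1) by blast
      ultimately show "insert w (T - {u}) \<subseteq> ?V \<and> card (insert w (T - {u})) = 3 \<and>
        \<not> collinear (insert w (T - {u})) \<and> ?int (insert w (T - {u})) \<inter> ?V = {}"
        using ncol[OF u] by simp
    qed
    have 5: "?int X \<inter> convex hull e = {}" if X: "X \<in> ?\<Phi>" and e: "e \<in> ?E" for X e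
    proof (rule \<Phi>_cases[OF X])
      assume XX: "X \<in> \<Phi>" "X \<noteq> T"
      show "?int X \<inter> convex hull e = {}"
      proof (rule E_cases[OF e])
        fix u assume u: "u \<in> T"
        show "?int X \<inter> convex hull {w, u} = {}"
          using spoke[OF u] D(11)[OF XX(1) T XX(2)] D(9)[OF XX(1)] TV(1)[OF u] by blast
      qed (use D(10)[OF XX(1)] in simp)
    next
      fix u assume u: "u \<in> T"
      show "?int (insert w (T - {u})) \<inter> convex hull e = {}"
      proof (rule E_cases[OF e])
        assume "e \<in> E" then show "?int (insert w (T - {u})) \<inter> convex hull e = {}" using sub[of u] D(10)[OF T, of e] by blast
      qed (use sub_spoke[OF u] in simp)
    qed
    have 6: "?int X \<inter> ?int Y = {}" if X: "X \<in> ?\<Phi>" "Y \<in> ?\<Phi>" "X \<noteq> Y" for X Y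
    proof -
      consider "X \<in> \<Phi>" "Y \<in> \<Phi>" | u where "X \<in> \<Phi>" "X \<noteq> T" "u \<in> T" "Y = insert w (T - {u})"
        | u where "Y \<in> \<Phi>" "Y \<noteq> T" "u \<in> T" "X = insert w (T - {u})"
        | u v where "u \<in> T" "v \<in> T" "X = insert w (T - {u})" "Y = insert w (T - {v})"
        using X(1,2) by blast
      then show ?thesis
      proof cases
        case 1 then show ?thesis using D(11) X(3) by simp
      next
        case (2 u) then show ?thesis using D(11)[OF 2(1) T 2(2)] sub[of u] by blast
      next
        case (3 u) then show ?thesis using D(11)[OF 3(1) T 3(2)] sub[of u] by blast
      next
        case (4 u v) then show ?thesis using subs[of u v] X(3) by blast
      qed
    qed
    show ?thesis unfolding triangulated_def using 1 2 3 4 5 6 by simp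
  qed
  then show thesis using that wV by blast
qed

text \<open>\<open>S\<close> is a vertex cover with \<open>s\<close> points, \<open>i\<close> further points are independent, \<open>k\<close> faces have all
  corners in \<open>S\<close>, and \<open>m\<close> counts the edges.\<close>

definition stacking :: "nat \<Rightarrow> nat \<Rightarrow> nat \<Rightarrow> nat \<Rightarrow> bool" where
  "stacking s i k m \<longleftrightarrow> (\<exists>V E \<Phi> S. triangulated V E \<Phi> \<and> S \<subseteq> V \<and> card S = s \<and> card (V - S) = i \<and>
     card {T \<in> \<Phi>. T \<subseteq> S} = k \<and> card E = m \<and> (\<forall>e\<in>E. e \<inter> S \<noteq> {}) \<and> (\<exists>T\<in>\<Phi>. card (T \<inter> S) = 2))"

lemma card_insert_spokes:
  assumes "triangulated V E \<Phi>" "w \<notin> V" "finite N" "N \<subseteq> V"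
  shows "card (E \<union> (\<lambda>u. {w, u}) ` N) = card E + card N"
proof -
  note D = triangulatedD[OF assms(1)]
  have "E \<inter> (\<lambda>u. {w, u}) ` N = {}" using D(2) assms(2) by blast
  moreover have "inj_on (\<lambda>u. {w, u}) N"
    by (rule inj_onI) (metis doubleton_eq_iff)
  ultimately show ?thesis
    using triangulated_finite(1)[OF assms(1)] assms(3) by (simp add: card_Un_disjoint card_image)
qed

lemma inner_faces_insert_outer:
  assumes "S \<subseteq> V" "w \<notin> V"
  shows "{X \<in> (\<Phi> - {T}) \<union> (\<lambda>u. insert w (T - {u})) ` T. X \<subseteq> S} = {X \<in> \<Phi>. X \<subseteq> S} - {T}"
  using assms by blast

text \<open>The number of new inner faces is three if T lies in S, and one if exactly two corners of
  T do.\<close>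

lemma card_inner_faces_insert_inner:
  assumes tri: "triangulated V E \<Phi>" and "S \<subseteq> V" "w \<notin> V" "T \<in> \<Phi>"
  shows "card {X \<in> (\<Phi> - {T}) \<union> (\<lambda>u. insert w (T - {u})) ` T. X \<subseteq> insert w S} =
    card ({X \<in> \<Phi>. X \<subseteq> S} - {T}) + card {u \<in> T. T - {u} \<subseteq> S}"
proof -
  note D = triangulatedD[OF tri]
  let ?N = "{u \<in> T. T - {u} \<subseteq> S}" and ?A = "{X \<in> \<Phi>. X \<subseteq> S} - {T}"
  have wX: "w \<notin> X" if "X \<in> \<Phi>" for X using D(6)[OF that] assms(3) by blast
  have "{X \<in> (\<Phi> - {T}) \<union> (\<lambda>u. insert w (T - {u})) ` T. X \<subseteq> insert w S} =
    ?A \<union> (\<lambda>u. insert w (T - {u})) ` ?N" (is "?L = ?R")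
  proof
    show "?L \<subseteq> ?R"
    proof
      fix X assume X: "X \<in> ?L"
      show "X \<in> ?R"
      proof (cases "X \<in> \<Phi> \<and> X \<noteq> T")
        case True then show ?thesis using X wX[of X] by blast
      next
        case False
        then obtain u where u: "u \<in> T" "X = insert w (T - {u})" using X by blast
        then have "T - {u} \<subseteq> S" using X wX[OF assms(4)] by blast
        then show ?thesis using u by blast
      qed
    qed
    show "?R \<subseteq> ?L"
    proof
      fix X assume "X \<in> ?R"
      then consider "X \<in> \<Phi>" "X \<subseteq> S" "X \<noteq> T" | u where "u \<in> T" "T - {u} \<subseteq> S" "X = insert w (T - {u})"
        by blast
      then show "X \<in> ?L" by cases auto
    qed
  qed
  moreover have "?A \<inter> (\<lambda>u. insert w (T - {u})) ` ?N = {}" using wX by blast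
  moreover have "inj_on (\<lambda>u. insert w (T - {u})) ?N"
  proof (rule inj_onI)
    fix u v assume uv: "u \<in> ?N" "v \<in> ?N" "insert w (T - {u}) = insert w (T - {v})"
    have "u \<noteq> w" using uv(1) wX[OF assms(4)] by blast
    then show "u = v" using uv by blast
  qed
  moreover have "finite ?A" "finite ?N"
    using triangulated_finite(2)[OF tri] D(1) finite_subset[OF D(6)[OF assms(4)]] by simp_all
  ultimately show ?thesis by (simp add: card_Un_disjoint card_image)
qed

text \<open>This step leaves the starting triangle, which has no face within the cover. The
  subtriangle opposite to the corner outside S becomes an inner face; the other two are mixed again,
  having exactly two cover corners.\<close>

lemma stacking_cover_in_mixed_face:
  assumes "stacking s i k m"
  shows "stacking (Suc s) i (Suc k) (m + 3)"
proof -
  obtain V E \<Phi> S T where tri: "triangulated V E \<Phi>" and S: "S \<subseteq> V" "card S = s" "card (V - S) = i"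
    "card {T \<in> \<Phi>. T \<subseteq> S} = k" "card E = m" "\<forall>e\<in>E. e \<inter> S \<noteq> {}" and T: "T \<in> \<Phi>" "card (T \<inter> S) = 2"
    using assms unfolding stacking_def by (elim exE conjE bexE)
  note D = triangulatedD[OF tri]
  obtain w where w: "w \<notin> V" and new: "\<And>N. N \<subseteq> T \<Longrightarrow> triangulated (insert w V) (E \<union> (\<lambda>u. {w, u}) ` N)
        ((\<Phi> - {T}) \<union> (\<lambda>u. insert w (T - {u})) ` T)"
    using triangulated_insert[OF tri T(1)] by blast
  let ?E = "E \<union> (\<lambda>u. {w, u}) ` T" and ?\<Phi> = "(\<Phi> - {T}) \<union> (\<lambda>u. insert w (T - {u})) ` T"
  have fin: "finite T" "finite S" using D(1) D(6)[OF T(1)] S(1) finite_subset by blast+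
  have wS: "w \<notin> S" "w \<notin> T" using w S(1) D(6)[OF T(1)] by blast+
  have "card (T - T \<inter> S) = 1" using D(7)[OF T(1)] T(2) fin by (simp add: card_Diff_subset)
  then obtain r where "T - T \<inter> S = {r}" by (rule card_1_singletonE)
  then have r: "r \<in> T" "r \<notin> S" "T - {r} \<subseteq> S" by blast+
  obtain a c where ac: "T \<inter> S = {a, c}" "a \<noteq> c" using T(2) unfolding card_2_iff by blast
  have "{u \<in> T. T - {u} \<subseteq> S} = {r}" using r by blast
  moreover have "T \<notin> {X \<in> \<Phi>. X \<subseteq> S}" using r by blast
  ultimately have "card {X \<in> ?\<Phi>. X \<subseteq> insert w S} = Suc k"
    using card_inner_faces_insert_inner[OF tri S(1) w T(1)] S(4) by simp
  moreover have "card ?E = m + 3"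
    using card_insert_spokes[OF tri w fin(1) D(6)[OF T(1)]] D(7)[OF T(1)] S(5) by simp
  moreover have "card (insert w S) = Suc s" using fin(2) wS(1) S(2) by simp
  moreover have "insert w V - insert w S = V - S" using w by blast
  moreover have "\<forall>e\<in>?E. e \<inter> insert w S \<noteq> {}" using S(6) by blast
  moreover have "insert w (T - {a}) \<inter> insert w S = {w, c}" using ac r by blast
  then have "card (insert w (T - {a}) \<inter> insert w S) = 2" using ac wS by auto
  then have "\<exists>X\<in>?\<Phi>. card (X \<inter> insert w S) = 2" using ac(1) by blast
  moreover have "insert w S \<subseteq> insert w V" using S(1) by blast
  ultimately show ?thesis
    unfolding stacking_def using new[OF order_refl] S(3)
    by (intro exI[of _ "insert w V"] exI[of _ ?E] exI[of _ ?\<Phi>] exI[of _ "insert w S"]) simp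
qed

lemma stacking_cover_in_inner_face:
  assumes "stacking s i (Suc k) m"
  shows "stacking (Suc s) i (k + 3) (m + 3)"
proof -
  obtain V E \<Phi> S T' where tri: "triangulated V E \<Phi>" and S: "S \<subseteq> V" "card S = s" "card (V - S) = i"
    "card {T \<in> \<Phi>. T \<subseteq> S} = Suc k" "card E = m" "\<forall>e\<in>E. e \<inter> S \<noteq> {}" and T': "T' \<in> \<Phi>" "card (T' \<inter> S) = 2"
    using assms unfolding stacking_def by (elim exE conjE bexE)
  note D = triangulatedD[OF tri]
  obtain T where T: "T \<in> \<Phi>" "T \<subseteq> S" using S(4) by (metis (lifting) card_eq_SucD insertI1 mem_Collect_eq)
  obtain w where w: "w \<notin> V" and new: "\<And>N. N \<subseteq> T \<Longrightarrow> triangulated (insert w V) (E \<union> (\<lambda>u. {w, u}) ` N)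
        ((\<Phi> - {T}) \<union> (\<lambda>u. insert w (T - {u})) ` T)"
    using triangulated_insert[OF tri T(1)] by blast
  let ?E = "E \<union> (\<lambda>u. {w, u}) ` T" and ?\<Phi> = "(\<Phi> - {T}) \<union> (\<lambda>u. insert w (T - {u})) ` T"
  have fin: "finite T" "finite S" using D(1) D(6)[OF T(1)] S(1) finite_subset by blast+
  have wS: "w \<notin> S" "w \<notin> T'" using w S(1) D(6)[OF T'(1)] by blast+
  have "{u \<in> T. T - {u} \<subseteq> S} = T" using T(2) by blast
  moreover have "card ({X \<in> \<Phi>. X \<subseteq> S} - {T}) = k" using S(4) T by simp
  ultimately have "card {X \<in> ?\<Phi>. X \<subseteq> insert w S} = k + 3"
    using card_inner_faces_insert_inner[OF tri S(1) w T(1)] D(7)[OF T(1)] by simp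
  moreover have "card ?E = m + 3"
    using card_insert_spokes[OF tri w fin(1) D(6)[OF T(1)]] D(7)[OF T(1)] S(5) by simp
  moreover have "card (insert w S) = Suc s" using fin(2) wS(1) S(2) by simp
  moreover have "insert w V - insert w S = V - S" using w by blast
  moreover have "\<forall>e\<in>?E. e \<inter> insert w S \<noteq> {}" using S(6) by blast
  moreover have "T' \<noteq> T" using T(2) T'(2) D(7)[OF T(1)] by (auto simp: Int_absorb2)
  then have "\<exists>X\<in>?\<Phi>. card (X \<inter> insert w S) = 2"
    using T' wS(2) by (intro bexI[of _ T']) simp_all
  moreover have "insert w S \<subseteq> insert w V" using S(1) by blast
  ultimately show ?thesis
    unfolding stacking_def using new[OF order_refl] S(3)
    by (intro exI[of _ "insert w V"] exI[of _ ?E] exI[of _ ?\<Phi>] exI[of _ "insert w S"]) simp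
qed

lemma stacking_independent_in_inner_face:
  assumes "stacking s i (Suc k) m"
  shows "stacking s (Suc i) k (m + 3)"
proof -
  obtain V E \<Phi> S T' where tri: "triangulated V E \<Phi>" and S: "S \<subseteq> V" "card S = s" "card (V - S) = i"
    "card {T \<in> \<Phi>. T \<subseteq> S} = Suc k" "card E = m" "\<forall>e\<in>E. e \<inter> S \<noteq> {}" and T': "T' \<in> \<Phi>" "card (T' \<inter> S) = 2"
    using assms unfolding stacking_def by (elim exE conjE bexE)
  note D = triangulatedD[OF tri]
  obtain T where T: "T \<in> \<Phi>" "T \<subseteq> S" using S(4) by (metis (lifting) card_eq_SucD insertI1 mem_Collect_eq)
  obtain w where w: "w \<notin> V" and new: "\<And>N. N \<subseteq> T \<Longrightarrow> triangulated (insert w V) (E \<union> (\<lambda>u. {w, u}) ` N)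
        ((\<Phi> - {T}) \<union> (\<lambda>u. insert w (T - {u})) ` T)"
    using triangulated_insert[OF tri T(1)] by blast
  let ?E = "E \<union> (\<lambda>u. {w, u}) ` T" and ?\<Phi> = "(\<Phi> - {T}) \<union> (\<lambda>u. insert w (T - {u})) ` T"
  have fin: "finite T" using D(1) D(6)[OF T(1)] finite_subset by blast
  have "card {X \<in> ?\<Phi>. X \<subseteq> S} = k"
    unfolding inner_faces_insert_outer[OF S(1) w] using S(4) T by simp
  moreover have "card ?E = m + 3"
    using card_insert_spokes[OF tri w fin D(6)[OF T(1)]] D(7)[OF T(1)] S(5) by simp
  moreover have "insert w V - S = insert w (V - S)" using w S(1) by blast
  then have "card (insert w V - S) = Suc i" using w D(1) S(3) by simp
  moreover have "\<forall>e\<in>?E. e \<inter> S \<noteq> {}" using S(6) T(2) by blast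
  moreover have "T' \<noteq> T" using T(2) T'(2) D(7)[OF T(1)] by (auto simp: Int_absorb2)
  then have "\<exists>X\<in>?\<Phi>. card (X \<inter> S) = 2"
    using T' by (intro bexI[of _ T']) simp_all
  moreover have "S \<subseteq> insert w V" using S(1) by blast
  ultimately show ?thesis
    unfolding stacking_def using new[OF order_refl] S(2)
    by (intro exI[of _ "insert w V"] exI[of _ ?E] exI[of _ ?\<Phi>] exI[of _ S]) simp
qed

text \<open>The new point is joined to the two cover corners only. The subtriangle over these
  corners is again mixed, so the step can be repeated without end.\<close>

lemma stacking_independent_in_mixed_face:
  assumes "stacking s i k m"
  shows "stacking s (Suc i) k (m + 2)"
proof -
  obtain V E \<Phi> S T where tri: "triangulated V E \<Phi>" and S: "S \<subseteq> V" "card S = s" "card (V - S) = i"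
    "card {T \<in> \<Phi>. T \<subseteq> S} = k" "card E = m" "\<forall>e\<in>E. e \<inter> S \<noteq> {}" and T: "T \<in> \<Phi>" "card (T \<inter> S) = 2"
    using assms unfolding stacking_def by (elim exE conjE bexE)
  note D = triangulatedD[OF tri]
  obtain w where w: "w \<notin> V" and new: "\<And>N. N \<subseteq> T \<Longrightarrow> triangulated (insert w V) (E \<union> (\<lambda>u. {w, u}) ` N)
        ((\<Phi> - {T}) \<union> (\<lambda>u. insert w (T - {u})) ` T)"
    using triangulated_insert[OF tri T(1)] by blast
  let ?N = "T \<inter> S"
  let ?E = "E \<union> (\<lambda>u. {w, u}) ` ?N" and ?\<Phi> = "(\<Phi> - {T}) \<union> (\<lambda>u. insert w (T - {u})) ` T"
  have fin: "finite T" using D(1) D(6)[OF T(1)] finite_subset by blast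
  have "card (T - T \<inter> S) = 1" using D(7)[OF T(1)] T(2) fin by (simp add: card_Diff_subset)
  then obtain r where "T - T \<inter> S = {r}" by (rule card_1_singletonE)
  then have r: "r \<in> T" "r \<notin> S" "T - {r} \<subseteq> S" by blast+
  have "T \<notin> {X \<in> \<Phi>. X \<subseteq> S}" using r by blast
  then have "card {X \<in> ?\<Phi>. X \<subseteq> S} = k"
    unfolding inner_faces_insert_outer[OF S(1) w] using S(4) by simp
  moreover have "finite ?N" "?N \<subseteq> V" using fin S(1) by blast+
  then have "card ?E = m + 2" using card_insert_spokes[OF tri w, of ?N] T(2) S(5) by simp
  moreover have "insert w V - S = insert w (V - S)" using w S(1) by blast
  then have "card (insert w V - S) = Suc i" using w D(1) S(3) by simp
  moreover have "\<forall>e\<in>?E. e \<inter> S \<noteq> {}" using S(6) by blast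
  moreover have "insert w (T - {r}) \<inter> S = T \<inter> S" using r w S(1) by blast
  then have "card (insert w (T - {r}) \<inter> S) = 2" using T(2) by simp
  then have "\<exists>X\<in>?\<Phi>. card (X \<inter> S) = 2" using r(1) by blast
  moreover have "S \<subseteq> insert w V" using S(1) by blast
  ultimately show ?thesis
    unfolding stacking_def using new[of ?N] S(2)
    by (intro exI[of _ "insert w V"] exI[of _ ?E] exI[of _ ?\<Phi>] exI[of _ S]) simp
qed

text \<open>The corner \<i> is kept out of the cover: once a cover point is put inside, it serves as
  the point in the outer face of the triangle of cover points. Thus all faces still to be filled are
  bounded.\<close>

lemma stacking_triangle: "stacking 2 1 0 3"
proof -
  let ?V = "{0, 1, \<i>}" and ?E = "{{0, 1}, {0, \<i>}, {1, \<i>}}"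
  have ncol: "\<not> collinear {0, 1, \<i>}"
    using collinear_lemma[of 1 \<i>] by (auto simp: complex_eq_iff)
  have int: "0 < Re p \<and> 0 < Im p \<and> Re p + Im p < 1" if "p \<in> interior (convex hull ?V)" for p
    using that interior_convex_hull_3_minimal[OF ncol] by (auto simp: scaleR_conv_of_real)
  have h1: "Im p = 0" if "p \<in> convex hull {0, 1}" for p
    using that unfolding segment_convex_hull[symmetric] in_segment by auto
  have h2: "Re p = 0" if "p \<in> convex hull {0, \<i>}" for p
    using that unfolding segment_convex_hull[symmetric] in_segment by auto
  have h3: "Re p + Im p = 1" if "p \<in> convex hull {1, \<i>}" for p
    using that unfolding segment_convex_hull[symmetric] in_segment by auto
  have "triangulated ?V ?E {?V}"
    unfolding triangulated_def
  proof (intro conjI)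
    show "simple_graph (?V, ?E)" by (auto simp: simple_graph_def complex_eq_iff)
    show "\<forall>e\<in>?E. convex hull e \<inter> ?V \<subseteq> e" using h1 h2 h3 by fastforce
    have p0: "p = 0" if "Im p = 0" "Re p = 0" for p using that by (simp add: complex_eq_iff)
    have p1: "p = 1" if "Im p = 0" "Re p + Im p = 1" for p using that by (simp add: complex_eq_iff)
    have p2: "p = \<i>" if "Re p = 0" "Re p + Im p = 1" for p using that by (simp add: complex_eq_iff)
    have "convex hull {0, 1} \<inter> convex hull {0, \<i>} \<subseteq> {0}" "convex hull {0, 1} \<inter> convex hull {1, \<i>} \<subseteq> {1}"
      "convex hull {0, \<i>} \<inter> convex hull {1, \<i>} \<subseteq> {\<i>}"
      using h1 h2 h3 p0 p1 p2 by blast+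
    then show "\<forall>e\<in>?E. \<forall>e'\<in>?E. e \<noteq> e' \<longrightarrow> convex hull e \<inter> convex hull e' \<subseteq> e \<inter> e'" by auto
    have "interior (convex hull ?V) \<inter> ?V = {}" using int by fastforce
    moreover have "card ?V = 3" by (simp add: complex_eq_iff)
    ultimately show "\<forall>T\<in>{?V}. T \<subseteq> ?V \<and> card T = 3 \<and> \<not> collinear T \<and> interior (convex hull T) \<inter> ?V = {}"
      using ncol by simp
    show "\<forall>T\<in>{?V}. \<forall>e\<in>?E. interior (convex hull T) \<inter> convex hull e = {}"
      using int h1 h2 h3 by fastforce
  qed simp
  moreover have "card ?E = 3" "card {0, 1::complex} = 2" "?V - {0, 1} = {\<i>}" "?V \<inter> {0, 1} = {0, 1}"
    by (auto simp: complex_eq_iff doubleton_eq_iff)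
  moreover have "{T \<in> {?V}. T \<subseteq> {0, 1}} = {}" by (auto simp: complex_eq_iff)
  ultimately show ?thesis
    unfolding stacking_def
    by (intro exI[of _ ?V] exI[of _ ?E] exI[of _ "{?V}"] exI[of _ "{0, 1}"]) simp
qed

text \<open>A stacked triangulation on n + 3 cover points has 2(n + 3) - 4 faces and 3(n + 3) - 6
  edges. Its outer face already contains the independent point, which leaves 2n + 1 faces and adds
  three edges.\<close>

lemma stacking_cover: "stacking (n + 3) 1 (2 * n + 1) (3 * n + 6)"
proof (induction n)
  case 0
  then show ?case using stacking_cover_in_mixed_face[OF stacking_triangle] by (simp add: eval_nat_numeral)
next
  case (Suc n)
  then have "stacking (n + 3) 1 (Suc (2 * n)) (3 * n + 6)" by simp
  from stacking_cover_in_inner_face[OF this]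
  have "stacking (Suc n + 3) 1 (2 * n + 3) (3 * n + 9)" by (simp add: add.commute)
  moreover have "2 * n + 3 = 2 * Suc n + 1" "3 * n + 9 = 3 * Suc n + 6" by simp_all
  ultimately show ?case by (simp only:)
qed

lemma stacking_full:
  assumes "j \<le> 2 * n + 1"
  shows "stacking (n + 3) (1 + j) (2 * n + 1 - j) (3 * n + 6 + 3 * j)"
  using assms
proof (induction j)
  case 0
  then show ?case using stacking_cover by simp
next
  case (Suc j)
  have "2 * n + 1 - j = Suc (2 * n + 1 - Suc j)" using Suc.prems by simp
  then have "stacking (n + 3) (1 + j) (Suc (2 * n + 1 - Suc j)) (3 * n + 6 + 3 * j)" using Suc by simp
  from stacking_independent_in_inner_face[OF this] show ?case by (simp add: algebra_simps)
qed

lemma stacking_large: "stacking (n + 3) (2 * n + 2 + d) 0 (9 * n + 9 + 2 * d)"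
proof (induction d)
  case 0
  then show ?case using stacking_full[of "2 * n + 1" n] by (simp add: algebra_simps)
next
  case (Suc d)
  from stacking_independent_in_mixed_face[OF this] show ?case by (simp add: algebra_simps)
qed

section \<open>Transfer to graphs on natural numbers\<close>

lemma stacking_nat_graph:
  assumes "stacking s i k m"
  obtains G :: "nat graph" and C where "simple_graph G" "planar G" "card (verts G) = s + i"
    "card (edges G) = m" "finite C" "card C = s" "\<forall>e\<in>edges G. e \<inter> C \<noteq> {}"
proof -
  obtain V E \<Phi> S T where tri: "triangulated V E \<Phi>" and S: "S \<subseteq> V" "card S = s" "card (V - S) = i"
    "card E = m" "\<forall>e\<in>E. e \<inter> S \<noteq> {}"
    using assms unfolding stacking_def by (elim exE conjE bexE)
  note D = triangulatedD[OF tri]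
  obtain h where h: "bij_betw h V {..<card V}"
    using ex_bij_betw_finite_nat[OF D(1)] by (auto simp: atLeast0LessThan)
  have inj: "inj_on h V" and im: "h ` V = {..<card V}" using h by (auto simp: bij_betw_def)
  \<comment> \<open>The vertices are points of the plane, so undoing the numbering places
    them.\<close>
  define p where "p = inv_into V h"
  have ph: "p (h x) = x" if "x \<in> V" for x unfolding p_def using inj that by (rule inv_into_f_f)
  have phe: "p ` h ` e = e" if "e \<subseteq> V" for e
  proof -
    have "p ` h ` e = (\<lambda>x. x) ` e" unfolding image_image using ph that by (intro image_cong) auto
    then show ?thesis by simp
  qed
  have "\<exists>g. arc g \<and> {pathstart g, pathfinish g} = e \<and> path_image g = convex hull e" if e: "e \<in> E" for e
  proof -
    obtain a b where ab: "e = {a, b}" "a \<noteq> b" using D(3)[OF e] unfolding card_2_iff by blast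
    then show ?thesis
      by (intro exI[of _ "linepath a b"]) (simp add: segment_convex_hull arc_linepath)
  qed
  then obtain \<gamma> where \<gamma>: "\<And>e. e \<in> E \<Longrightarrow> arc (\<gamma> e)" "\<And>e. e \<in> E \<Longrightarrow> {pathstart (\<gamma> e), pathfinish (\<gamma> e)} = e"
    "\<And>e. e \<in> E \<Longrightarrow> path_image (\<gamma> e) = convex hull e"
    by metis
  let ?G = "(h ` V, (\<lambda>e. h ` e) ` E)"
  have "plane_drawing ?G p (\<lambda>e. \<gamma> (p ` e))"
    unfolding plane_drawing_def fst_conv snd_conv
  proof (intro conjI ballI impI)
    show "inj_on p (h ` V)" by (rule inj_onI) (auto simp: ph)
    fix e' assume "e' \<in> (\<lambda>e. h ` e) ` E"
    then obtain e where e: "e' = h ` e" "e \<in> E" by blast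
    have pe: "p ` e' = e" using e phe D(2) by simp
    show "arc (\<gamma> (p ` e'))" "{pathstart (\<gamma> (p ` e')), pathfinish (\<gamma> (p ` e'))} = p ` e'"
      unfolding pe using \<gamma> e(2) by simp_all
    have "e \<subseteq> convex hull e" by (rule hull_subset)
    then have "convex hull e \<inter> V = e" using D(2,4)[OF e(2)] by blast
    then show "path_image (\<gamma> (p ` e')) \<inter> p ` h ` V = p ` e'"
      unfolding pe \<gamma>(3)[OF e(2)] phe[OF order_refl] .
    fix f' assume "f' \<in> (\<lambda>e. h ` e) ` E" and ne: "e' \<noteq> f'"
    then obtain f where f: "f' = h ` f" "f \<in> E" by blast
    have pf: "p ` f' = f" using f phe D(2) by simp
    have "convex hull e \<inter> convex hull f \<subseteq> e \<inter> f" using D(5)[OF e(2) f(2)] ne e(1) f(1) by blast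
    also have "\<dots> \<subseteq> p ` (e' \<inter> f')"
    proof
      fix x assume x: "x \<in> e \<inter> f"
      then have "h x \<in> e' \<inter> f'" "p (h x) = x" using e f D(2) ph by blast+
      then show "x \<in> p ` (e' \<inter> f')" by (metis imageI)
    qed
    finally show "path_image (\<gamma> (p ` e')) \<inter> path_image (\<gamma> (p ` f')) \<subseteq> p ` (e' \<inter> f')"
      unfolding pe pf \<gamma>(3)[OF e(2)] \<gamma>(3)[OF f(2)] .
  qed
  then have planar: "planar ?G" unfolding planar_def by blast
  have injE: "inj_on (\<lambda>e. h ` e) E"
    by (rule inj_on_inverseI[of _ "\<lambda>e. p ` e"]) (simp add: phe D(2))
  show thesis
  proof (rule that[of ?G "h ` S"])
    have "card (h ` e) = 2" "h ` e \<subseteq> h ` V" if "e \<in> E" for e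
      using D(2,3)[OF that] inj_on_subset[OF inj D(2)[OF that]] by (simp_all add: card_image image_mono)
    then show "simple_graph ?G" using D(1) unfolding simple_graph_def by auto
    have "finite S" using S(1) D(1) by (rule finite_subset)
    then have "card V = s + i"
      using S(1-3) D(1) card_mono[of V S] by (simp add: card_Diff_subset)
    then show "card (verts ?G) = s + i" using inj by (simp add: card_image)
    show "card (edges ?G) = m" using injE S(4) by (simp add: card_image)
    show "finite (h ` S)" "card (h ` S) = s"
      using \<open>finite S\<close> S(2) inj_on_subset[OF inj S(1)] by (simp_all add: card_image)
    show "\<forall>e\<in>edges ?G. e \<inter> h ` S \<noteq> {}" using S(5) by auto
  qed (fact planar)
qed

section \<open>The planar Turan number of a matching\<close>

lemma card_matching_le_cover:
  assumes M: "is_matching E M" and C: "finite C" "\<And>e. e \<in> E \<Longrightarrow> e \<inter> C \<noteq> {}"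
  shows "card M \<le> card C"
proof -
  have "\<exists>x. x \<in> e \<inter> C" if "e \<in> M" for e using C(2)[OF is_matching_edge[OF M that]] by blast
  then obtain f where f: "\<And>e. e \<in> M \<Longrightarrow> f e \<in> e \<inter> C" by metis
  have "inj_on f M"
  proof (rule inj_onI)
    fix e e' assume e: "e \<in> M" "e' \<in> M" "f e = f e'"
    show "e = e'" by (rule is_matching_unique[OF M e(1,2), of "f e"]) (use f[OF e(1)] f[OF e(2)] e(3) in auto)
  qed
  moreover have "f ` M \<subseteq> C" using f by blast
  ultimately show ?thesis using C(1) by (rule card_inj_on_le)
qed

lemma planar_turan_sizes_matching_le:
  assumes "4 \<le> t" "2 * t \<le> n" "m \<in> planar_turan_sizes n (matching_graph t)"
  shows "m + 6 \<le> 3 * n" "m + 13 \<le> 2 * n + 3 * t"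
proof -
  obtain G :: "nat graph" where G: "m = card (edges G)" "simple_graph G" "card (verts G) = n" "planar G"
    "\<not> contains_copy G (matching_graph t)"
    using assms(3) unfolding planar_turan_sizes_def by blast
  have VE: "simple_graph (verts G, edges G)" "planar (verts G, edges G)" using G by simp_all
  have "card M < t" if M: "is_matching (edges G) M" for M
  proof (rule ccontr)
    assume "\<not> card M < t"
    then obtain M' where M': "M' \<subseteq> M" "card M' = t" by (metis not_less obtain_subset_with_card_n)
    from matching_imp_contains_copy[OF G(2) is_matching_subset[OF M M'(1)] M'(2)]
    show False using G(5) by simp
  qed
  from planar_no_matching_card_edges_le[OF VE this assms(1)]
  show "m + 13 \<le> 2 * n + 3 * t" using G(1,3) assms(2) by simp
  show "m + 6 \<le> 3 * n" using planar_card_edges_le[OF VE] G(1,3) assms(1,2) by simp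
qed

lemma stacking_planar_turan_sizes:
  assumes "stacking s i k m" "s < t"
  shows "m \<in> planar_turan_sizes (s + i) (matching_graph t)"
proof -
  obtain G :: "nat graph" and C where G: "simple_graph G" "planar G" "card (verts G) = s + i"
    "card (edges G) = m" and C: "finite C" "card C = s" "\<forall>e\<in>edges G. e \<inter> C \<noteq> {}"
    by (rule stacking_nat_graph[OF assms(1)])
  have "\<not> contains_copy G (matching_graph t)"
  proof
    assume "contains_copy G (matching_graph t)"
    then obtain M where M: "is_matching (edges G) M" "card M = t" by (rule contains_copy_imp_matching)
    show False using card_matching_le_cover[OF M(1) C(1) bspec[OF C(3)]] M(2) C(2) assms(2) by simp
  qed
  then show ?thesis using G unfolding planar_turan_sizes_def by blast
qed

theorem theorem1p5:
  fixes t n :: nat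
  assumes "t \<ge> 4" and "n \<ge> 2 * t"
  shows "int (planar_turan_number n (matching_graph t)) =
           min (3 * int n - 6) (2 * int n + 3 * int t - 13)"
proof -
  \<comment> \<open>The cover will have t - 1 = k + 3 points.\<close>
  define k where "k = t - 4"
  have t: "t = k + 4" using assms(1) by (simp add: k_def)
  obtain m where m: "m \<in> planar_turan_sizes n (matching_graph t)"
    "int m = min (3 * int n - 6) (2 * int n + 3 * int t - 13)"
  \<comment> \<open>The threshold 3k + 5 = 3t - 7 is where the two terms of the minimum
    agree.\<close>
  proof (cases "n \<le> 3 * k + 5")
    case True
    \<comment> \<open>One independent point is present from the start, hence k + 4 instead of k +
      3.\<close>
    define j where "j = n - (k + 4)"
    have n: "n = (k + 3) + (1 + j)" using assms(2) t by (simp add: j_def)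
    have "j \<le> 2 * k + 1" using True n by simp
    from stacking_planar_turan_sizes[OF stacking_full[OF this], of t]
    have "3 * k + 6 + 3 * j \<in> planar_turan_sizes n (matching_graph t)" using n t by simp
    then show thesis by (rule that) (use True n t in simp)
  next
    case False
    define d where "d = n - (3 * k + 5)"
    have n: "n = (k + 3) + (2 * k + 2 + d)" using False by (simp add: d_def)
    from stacking_planar_turan_sizes[OF stacking_large[of k d], of t]
    have "9 * k + 9 + 2 * d \<in> planar_turan_sizes n (matching_graph t)" using n t by simp
    then show thesis by (rule that) (use False n t in simp)
  qed
  have "planar_turan_number n (matching_graph t) = m"
    unfolding planar_turan_number_def
  proof (rule Max_eqI[OF finite_planar_turan_sizes _ m(1)])
    fix x assume "x \<in> planar_turan_sizes n (matching_graph t)"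
    from planar_turan_sizes_matching_le[OF assms this] show "x \<le> m" using m(2) by linarith
  qed
  then show ?thesis using m(2) by simp
qed

end
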